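(* Consider the problem $\min_{x\in C}F(x)$ with $F(x)=f(x)+h(Ax)-g(x)$, with data $\mathcal H,\mathcal K,C,A,f,h,\ell,g,\beta$ satisfying the standing assumptions given in the context. Let $(x_n)_{n\in\mathbb N}$ be a sequence generated by the proximal subgradient algorithm with extrapolation described in the context, with parameters $\overline\lambda,\overline\mu\in\mathbb R_+$, $\delta\in\mathbb R_{++}$ and step sizes $(\tau_n)_{n\in\mathbb N}$, started at $x_{-1}=x_0\in C$. Suppose that $F$ is bounded from below on $C$ and that the set $C_0:=\{x\in C: F(x)\le F(x_0)\}$ is bounded. Set $c:=\frac12(\ell\|A\|^2\overline\lambda+\overline\mu)$. Then the following statements hold: (i) For all $n\in\mathbb N$, $$\bigl(F(x_{n+1})+c\|x_{n+1}-x_n\|^2\bigr)+\delta\|x_{n+1}-x_n\|^2\le F(x_n)+c\|x_n-x_{n-1}\|^2,$$ and the sequence $(F(x_n))_{n\in\mathbb N}$ is convergent. (ii) The sequence $(x_n)_{n\in\mathbb N}$ is bounded and $x_{n+1}-x_n\to0$ as $n\to+\infty$. (iii) Suppose that $\liminf_{n\to+\infty}\tau_n=\overline\tau>0$ and let $\overline x$ be a cluster point of $(x_n)_{n\in\mathbb N}$. Then $\overline x\in C\cap\operatorname{dom}f$, $F(x_n)\to F(\overline x)$, and $\overline x$ is a lifted stationary point of the problem. Moreover, $\overline x$ is a stationary point of the problem provided that $g$ is strictly differentiable on an open set containing $C\cap\operatorname{dom}f$.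
   Context: Notation: $\mathbb N=\{0,1,2,\dots\}$, $\mathbb R_+=[0,+\infty)$, $\mathbb R_{++}=(0,+\infty)$. For $\phi:\mathcal H\to[-\infty,+\infty]$, $\operatorname{dom}\phi=\{x:\phi(x)<+\infty\}$; $\phi$ is proper if $\operatorname{dom}\phi\ne\varnothing$ and $\phi$ never takes the value $-\infty$. $\iota_C$ is the indicator function of $C$ ($0$ on $C$, $+\infty$ off $C$). $A^*$ is the adjoint of $A$ and $\|A\|$ its operator norm. Weak convexity: $\phi$ is weakly convex if $\phi+\frac{\alpha}{2}\|\cdot\|^2$ is convex for some $\alpha\in\mathbb R_+$; its modulus is the smallest such $\alpha$. $\phi$ is weakly convex on a set $O$ with modulus $\alpha$ if $\phi+\iota_O$ is weakly convex with modulus $\alpha$. Standing assumptions: $\mathcal H,\mathcal K$ are finite-dimensional real Hilbert spaces; $C\subseteq\mathcal H$ is nonempty and closed; $A:\mathcal H\to\mathcal K$ is linear; $f:\mathcal H\to(-\infty,+\infty]$ is proper and lower semicontinuous (possibly nonsmooth and nonconvex); $h:\mathcal K\to\mathbb R$ is differentiable (possibly nonconvex) with gradient Lipschitz continuous with modulus $\ell$; $g:\mathcal H\to(-\infty,+\infty]$ is (finite-valued,) continuous and weakly convex with modulus $\beta$ on an open convex set containing $C$. The objective is $F(x)=f(x)+h(Ax)-g(x)$. Subdifferentials: for $\phi:\mathcal H\to[-\infty,+\infty]$ and $x$ with $|\phi(x)|<+\infty$, the Fréchet subdifferential is $$\widehat\partial\phi(x)=\Bigl\{x^*\in\mathcal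 H:\ \liminf_{y\to x}\frac{\phi(y)-\phi(x)-\langle x^*,y-x\rangle}{\|y-x\|}\ge0\Bigr\},$$ and the limiting subdifferential $\partial_L\phi(x)$ is the set of $x^*\in\mathcal H$ for which there exist $x_n\to x$ with $\phi(x_n)\to\phi(x)$ and $x_n^*\in\widehat\partial\phi(x_n)$ with $x_n^*\to x^*$. Both are empty if $|\phi(x)|=+\infty$. Stationarity: a point $\overline x\in C$ is a stationary point of the problem if $0\in\partial_L(f+\iota_C+h\circ A-g)(\overline x)$, and a lifted stationary point if $0\in\partial_L(f+\iota_C)(\overline x)+A^*\nabla h(A\overline x)-\partial_Lg(\overline x)$. Strict differentiability of $g$ at $x$ means that there is a vector $\nabla g(x)$ with $\lim_{y,z\to x,\,y\ne z}\frac{g(y)-g(z)-\langle\nabla g(x),y-z\rangle}{\|y-z\|}=0$. Algorithm (proximal subgradient algorithm with extrapolation): let $x_{-1}=x_0\in C$, $\overline\lambda\in\mathbb R_+$, $\overline\mu\in\mathbb R_+$, $\delta\in\mathbb R_{++}$. For each $n=0,1,2,\dots$, choose $$\tau_n\in\Bigl(0,\ \frac{1}{\beta+2\delta+\ell\|A\|^2(2\overline\lambda+1)+2\overline\mu}\Bigr],\quad \lambda_n\in[0,\overline\lambda],\quad \mu_n\in[0,\overline\mu\tau_n],\quad g_n\in\partial_Lg(x_n),$$ set $u_n=x_n+\lambda_n(x_n-x_{n-1})$ and $v_n=x_n+\mu_n(x_n-x_{n-1})$, and take $$x_{n+1}\in\operatorname*{argmin}_{x\in C}\Bigl(f(x)+\tfrac1{2\tau_n}\|x-v_n+\tau_nA^*\nabla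 h(Au_n)-\tau_ng_n\|^2\Bigr).$$ The sequence $(x_n)_{n\in\mathbb N}$ is infinite (no termination criterion is applied). By the usual convention, the argmin of a function that is identically $+\infty$ on $C$ is empty, so minimizers have finite objective value. *)

theory Defs
  imports "HOL-Analysis.Analysis"
begin

definition edom :: "('a \<Rightarrow> ereal) \<Rightarrow> 'a set" where
  "edom \<phi> = {x. \<phi> x < \<infinity>}"

definition proper_fun :: "('a \<Rightarrow> ereal) \<Rightarrow> bool" where
  "proper_fun \<phi> \<longleftrightarrow> edom \<phi> \<noteq> {} \<and> (\<forall>x. \<phi> x \<noteq> -\<infinity>)"

definition lsc :: "('a::topological_space \<Rightarrow> ereal) \<Rightarrow> bool" where
  "lsc \<phi> \<longleftrightarrow> (\<forall>x. \<phi> x \<le> Liminf (at x) \<phi>)"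

definition ind_fun :: "'a set \<Rightarrow> 'a \<Rightarrow> ereal" where
  "ind_fun S x = (if x \<in> S then 0 else \<infinity>)"

text \<open>Convexity of an extended-real-valued function is convexity of its epigraph.\<close>

definition econvex :: "('a::real_vector \<Rightarrow> ereal) \<Rightarrow> bool" where
  "econvex \<phi> \<longleftrightarrow> convex {(x, r::real). \<phi> x \<le> ereal r}"

text \<open>The modulus of weak convexity is the smallest admissible constant.\<close>

definition weakly_convex_modulus :: "('a::real_inner \<Rightarrow> ereal) \<Rightarrow> real \<Rightarrow> bool" where
  "weakly_convex_modulus \<phi> \<alpha> \<longleftrightarrow>
     0 \<le> \<alpha> \<and> econvex (\<lambda>x. \<phi> x + ereal (\<alpha> / 2 * (norm x)\<^sup>2)) \<and>
     (\<forall>\<alpha>'\<ge>0. econvex (\<lambda>x. \<phi> x + ereal (\<alpha>' / 2 * (norm x)\<^sup>2)) \<longrightarrow> \<alpha> \<le> \<alpha>')"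

definition weakly_convex_modulus_on ::
    "'a set \<Rightarrow> ('a::real_inner \<Rightarrow> ereal) \<Rightarrow> real \<Rightarrow> bool" where
  "weakly_convex_modulus_on S \<phi> \<alpha> \<longleftrightarrow> weakly_convex_modulus (\<lambda>x. \<phi> x + ind_fun S x) \<alpha>"

definition frechet_subdiff :: "('a::real_inner \<Rightarrow> ereal) \<Rightarrow> 'a \<Rightarrow> 'a set" where
  "frechet_subdiff \<phi> x =
     {v. \<bar>\<phi> x\<bar> \<noteq> \<infinity> \<and>
         Liminf (at x) (\<lambda>y. (\<phi> y - \<phi> x - ereal (v \<bullet> (y - x))) / ereal (norm (y - x))) \<ge> 0}"

definition limiting_subdiff :: "('a::real_inner \<Rightarrow> ereal) \<Rightarrow> 'a \<Rightarrow> 'a set" where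
  "limiting_subdiff \<phi> x =
     {v. \<bar>\<phi> x\<bar> \<noteq> \<infinity> \<and>
         (\<exists>xs vs. xs \<longlonglongrightarrow> x \<and> (\<lambda>n. \<phi> (xs n)) \<longlonglongrightarrow> \<phi> x \<and>
            (\<forall>n. vs n \<in> frechet_subdiff \<phi> (xs n)) \<and> vs \<longlonglongrightarrow> v)}"

text \<open>
  A limit along \<open>y, z \<rightarrow> x\<close> with \<open>y \<noteq> z\<close>.  An infinite value of
  \<open>\<phi>\<close> makes the quotient infinite (also \<open>\<infinity> - \<infinity> = \<infinity>\<close> for the type \<open>ereal\<close>), so the
  limit \<open>0\<close> forces \<open>\<phi>\<close> to be finite near \<open>x\<close>.
\<close>

definition strictly_differentiable :: "('a::real_inner \<Rightarrow> ereal) \<Rightarrow> 'a \<Rightarrow> bool" where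
  "strictly_differentiable \<phi> x \<longleftrightarrow>
     (\<exists>v. ((\<lambda>(y, z). (\<phi> y - \<phi> z - ereal (v \<bullet> (y - z))) / ereal (norm (y - z))) \<longlongrightarrow> 0)
            (at (x, x) within {(y, z). y \<noteq> z}))"

text \<open>Minimizers have finite value: the argmin of a function identically \<open>\<infinity>\<close> on \<open>S\<close> is empty.\<close>

definition argmin_on :: "'a set \<Rightarrow> ('a \<Rightarrow> ereal) \<Rightarrow> 'a set" where
  "argmin_on S \<phi> = {x. is_arg_min \<phi> (\<lambda>y. y \<in> S) x \<and> \<phi> x < \<infinity>}"

text \<open>
  Where \<open>f\<close> and \<open>g\<close> are both \<open>\<infinity>\<close>, the value is \<open>\<infinity> - \<infinity> = \<infinity>\<close>.  This can happen only outside
  the domain where \<open>g\<close> is required to be finite, hence outside the constraint set.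
\<close>

definition objective ::
    "('a \<Rightarrow> ereal) \<Rightarrow> ('b \<Rightarrow> real) \<Rightarrow> ('a \<Rightarrow> 'b) \<Rightarrow> ('a \<Rightarrow> ereal) \<Rightarrow> 'a \<Rightarrow> ereal" where
  "objective f h A g x = f x + ereal (h (A x)) - g x"

definition stationary_point ::
    "'a set \<Rightarrow> ('a::real_inner \<Rightarrow> ereal) \<Rightarrow> ('b \<Rightarrow> real) \<Rightarrow> ('a \<Rightarrow> 'b) \<Rightarrow> ('a \<Rightarrow> ereal) \<Rightarrow> 'a \<Rightarrow> bool"
  where
  "stationary_point C f h A g x \<longleftrightarrow>
     x \<in> C \<and> 0 \<in> limiting_subdiff (\<lambda>y. f y + ind_fun C y + ereal (h (A y)) - g y) x"

text \<open>The argument \<open>Dh\<close> is the gradient of \<open>h\<close>.\<close>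

definition lifted_stationary_point ::
    "'a set \<Rightarrow> ('a::real_inner \<Rightarrow> ereal) \<Rightarrow> ('b::real_inner \<Rightarrow> 'b) \<Rightarrow> ('a \<Rightarrow> 'b) \<Rightarrow>
     ('a \<Rightarrow> ereal) \<Rightarrow> 'a \<Rightarrow> bool"
  where
  "lifted_stationary_point C f Dh A g x \<longleftrightarrow>
     x \<in> C \<and>
     0 \<in> {p + adjoint A (Dh (A x)) - q | p q.
            p \<in> limiting_subdiff (\<lambda>y. f y + ind_fun C y) x \<and> q \<in> limiting_subdiff g x}"

text \<open>
  The previous iterate is written \<open>x (n - 1)\<close>: with truncated subtraction on the naturals,
  this is \<open>x 0\<close> for \<open>n = 0\<close>, which encodes the initialisation \<open>x\<^sub>-\<^sub>1 = x\<^sub>0\<close>.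
\<close>

definition prox_subgrad_extrapolation ::
    "'a set \<Rightarrow> ('a::real_inner \<Rightarrow> ereal) \<Rightarrow> ('b::real_inner \<Rightarrow> 'b) \<Rightarrow> real \<Rightarrow> ('a \<Rightarrow> 'b) \<Rightarrow>
     ('a \<Rightarrow> ereal) \<Rightarrow> real \<Rightarrow> real \<Rightarrow> real \<Rightarrow> real \<Rightarrow>
     (nat \<Rightarrow> real) \<Rightarrow> (nat \<Rightarrow> real) \<Rightarrow> (nat \<Rightarrow> real) \<Rightarrow> (nat \<Rightarrow> 'a) \<Rightarrow> (nat \<Rightarrow> 'a) \<Rightarrow> bool"
  where
  "prox_subgrad_extrapolation C f Dh ell A g \<beta> lam_max mu_max \<delta> \<tau> lam \<mu> gs x \<longleftrightarrow>
     x 0 \<in> C \<and>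
     (\<forall>n. \<tau> n \<in> {0 <.. 1 / (\<beta> + 2 * \<delta> + ell * (onorm A)\<^sup>2 * (2 * lam_max + 1) + 2 * mu_max)} \<and>
          lam n \<in> {0..lam_max} \<and>
          \<mu> n \<in> {0..mu_max * \<tau> n} \<and>
          gs n \<in> limiting_subdiff g (x n) \<and>
          (let u = x n + lam n *\<^sub>R (x n - x (n - 1));
               v = x n + \<mu> n *\<^sub>R (x n - x (n - 1))
           in x (Suc n) \<in> argmin_on C
                (\<lambda>y. f y + ereal (1 / (2 * \<tau> n) *
                   (norm (y - v + \<tau> n *\<^sub>R adjoint A (Dh (A u)) - \<tau> n *\<^sub>R gs n))\<^sup>2))))"

end

theory Submission
  imports Defs
begin

text \<open>
  Comparing the prox objective at \<open>x (n + 1)\<close> and \<open>x n\<close>, and inserting the quadratic bounds for \<open>h\<close>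
  (Lipschitz gradient) and \<open>g\<close> (weak convexity), shows that \<open>F (x n) + c * (norm (x n - x (n - 1)))\<^sup>2\<close>
  decreases by at least \<open>\<delta> * (norm (x (n + 1) - x n))\<^sup>2\<close>, which gives (i) and (ii).
  For (iii), no diagonal argument in the definition of the limiting subdifferential is needed: the prox
  inequality and the subgradient inequality for \<open>g\<close> both carry a quadratic error that is uniform in \<open>n\<close>, so
  they survive the passage to the limit and yield Frechet subgradients at the cluster point itself.
  If \<open>g\<close> is differentiable there, its only Frechet subgradient is the gradient, and the Frechet
  subgradients of the three summands add up to \<open>0\<close>.
\<close>

section \<open>Frechet and limiting subgradients\<close>

text \<open>Multiplying the difference quotient by \<open>norm (y - x) > 0\<close> trades the liminf
  for affine minorants with error \<open>e * norm (y - x)\<close>. Together with the converse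
  \<open>frechet_subdiffD\<close> this keeps extended-real quotients out of the later work with
  subgradients.\<close>

lemma frechet_subdiffI:
  fixes \<phi> :: "'a::real_inner \<Rightarrow> ereal"
  assumes r: "\<phi> x = ereal r"
    and ev: "\<And>e. e > 0 \<Longrightarrow> eventually (\<lambda>y. ereal (r + v \<bullet> (y - x) - e * norm (y - x)) \<le> \<phi> y) (at x)"
  shows "v \<in> frechet_subdiff \<phi> x"
proof -
  have "eventually (\<lambda>y. a < (\<phi> y - \<phi> x - ereal (v \<bullet> (y - x))) / ereal (norm (y - x))) (at x)"
    if a: "a < 0" for a
  proof -
    \<comment> \<open>\<open>a\<close> may be \<open>-\<infinity>\<close>, so a real
      \<open>z\<close> in between is chosen; \<open>- z\<close> plays the part of
      \<open>e\<close>.\<close>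
    obtain z where z: "a < ereal z" "ereal z < 0" using ereal_dense2[OF a] by auto
    hence "- z > 0" by simp
    from ev[OF this] have "eventually (\<lambda>y. ereal (r + v \<bullet> (y - x) - (-z) * norm (y - x)) \<le> \<phi> y) (at x)" .
    moreover have "eventually (\<lambda>y. y \<noteq> x) (at x)" by (rule eventually_neq_at_within)
    ultimately show ?thesis
    proof eventually_elim
      case (elim y)
      hence n: "norm (y - x) > 0" by simp
      show ?case
      proof (cases "\<phi> y")
        case (real s)
        have "r + v \<bullet> (y - x) + z * norm (y - x) \<le> s" using elim real by simp
        hence "z \<le> (s - r - v \<bullet> (y - x)) / norm (y - x)"
          using n by (simp add: pos_le_divide_eq)
        hence "ereal z \<le> (\<phi> y - \<phi> x - ereal (v \<bullet> (y - x))) / ereal (norm (y - x))"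
          using n real r by simp
        thus ?thesis using z(1) by (rule less_le_trans[rotated])
      next
        case PInf
        thus ?thesis using n r z(1) by (cases a) auto
      next
        case MInf
        thus ?thesis using elim by simp
      qed
    qed
  qed
  thus ?thesis unfolding frechet_subdiff_def using r by (simp add: le_Liminf_iff)
qed

lemma frechet_subdiffD:
  fixes \<phi> :: "'a::real_inner \<Rightarrow> ereal"
  assumes v: "v \<in> frechet_subdiff \<phi> x" and r: "\<phi> x = ereal r" and e: "e > 0"
  shows "eventually (\<lambda>y. ereal (r + v \<bullet> (y - x) - e * norm (y - x)) \<le> \<phi> y) (at x)"
proof -
  have "ereal (-e) < 0" using e by simp
  hence "eventually (\<lambda>y. ereal (-e) < (\<phi> y - \<phi> x - ereal (v \<bullet> (y - x))) / ereal (norm (y - x))) (at x)"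
    using v unfolding frechet_subdiff_def le_Liminf_iff by blast
  moreover have "eventually (\<lambda>y. y \<noteq> x) (at x)" by (rule eventually_neq_at_within)
  ultimately show ?thesis
  proof eventually_elim
    case (elim y)
    hence n: "norm (y - x) > 0" by simp
    show ?case
    proof (cases "\<phi> y")
      case (real s)
      have "-e < (s - r - v \<bullet> (y - x)) / norm (y - x)" using elim(1) real r n by simp
      hence "-e * norm (y - x) < s - r - v \<bullet> (y - x)" using n by (simp add: pos_less_divide_eq)
      thus ?thesis using real by simp
    next
      case PInf
      thus ?thesis by simp
    next
      case MInf
      thus ?thesis using elim(1) r n by simp
    qed
  qed
qed

lemma quadratic_le_linear_eventually:
  fixes x :: "'a::real_normed_vector"
  assumes "e > 0"
  shows "eventually (\<lambda>y. K * (norm (y - x))\<^sup>2 \<le> e * norm (y - x)) (at x)"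
proof -
  have "((\<lambda>y. K * norm (y - x)) \<longlongrightarrow> K * norm (x - x)) (at x)" by (intro tendsto_intros)
  hence "eventually (\<lambda>y. K * norm (y - x) < e) (at x)" using assms by (simp add: order_tendstoD(2))
  thus ?thesis
  proof eventually_elim
    case (elim y)
    hence "K * norm (y - x) * norm (y - x) \<le> e * norm (y - x)" by (intro mult_right_mono) auto
    thus ?case by (simp add: power2_eq_square mult.assoc)
  qed
qed

text \<open>A quadratic error is eventually below every \<open>e * norm (y - x)\<close>. This is how
  the quadratic inequalities obtained in the limit become Frechet subgradients.\<close>

lemma frechet_subdiff_quadraticI:
  fixes \<phi> :: "'a::real_inner \<Rightarrow> ereal"
  assumes r: "\<phi> x = ereal r"
    and ev: "eventually (\<lambda>y. ereal (r + v \<bullet> (y - x) - K * (norm (y - x))\<^sup>2) \<le> \<phi> y) (at x)"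
  shows "v \<in> frechet_subdiff \<phi> x"
proof (rule frechet_subdiffI[of \<phi> x r v])
  show "\<phi> x = ereal r" by fact
next
  fix e :: real assume e: "e > 0"
  from ev quadratic_le_linear_eventually[OF e, of K x]
  show "eventually (\<lambda>y. ereal (r + v \<bullet> (y - x) - e * norm (y - x)) \<le> \<phi> y) (at x)"
  proof eventually_elim
    case (elim y)
    show ?case using elim(2) by (intro order_trans[OF _ elim(1)]) simp
  qed
qed

lemma frechet_subset_limiting: "frechet_subdiff \<phi> x \<subseteq> limiting_subdiff \<phi> x"
proof
  fix v assume v: "v \<in> frechet_subdiff \<phi> x"
  hence "\<bar>\<phi> x\<bar> \<noteq> \<infinity>" by (simp add: frechet_subdiff_def)
  moreover have "\<exists>xs vs. xs \<longlonglongrightarrow> x \<and> (\<lambda>n. \<phi> (xs n)) \<longlonglongrightarrow> \<phi> x \<and>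
      (\<forall>n. vs n \<in> frechet_subdiff \<phi> (xs n)) \<and> vs \<longlonglongrightarrow> v"
    using v by (intro exI[of _ "\<lambda>_. x"] exI[of _ "\<lambda>_. v"]) simp
  ultimately show "v \<in> limiting_subdiff \<phi> x" by (simp add: limiting_subdiff_def)
qed

section \<open>Subgradient inequalities for weakly convex functions\<close>

text \<open>Convexity of \<open>g\<close> plus \<open>\<beta> / 2\<close> times the squared norm,
  read on the epigraph over \<open>U\<close>; the quadratic surplus remains from expanding the
  squared norm of a convex combination.\<close>

lemma weakly_convex_segment_le:
  fixes g :: "'a::real_inner \<Rightarrow> ereal"
  assumes wc: "weakly_convex_modulus_on U g \<beta>" and U: "convex U" and fin: "\<And>y. y \<in> U \<Longrightarrow> g y = ereal (G y)"
    and y: "y \<in> U" and z: "z \<in> U" and t: "0 \<le> t" "t \<le> 1"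
  shows "G (z + t *\<^sub>R (y - z)) \<le> (1 - t) * G z + t * G y + \<beta> / 2 * t * (1 - t) * (norm (y - z))\<^sup>2"
proof -
  let ?w = "(1 - t) *\<^sub>R z + t *\<^sub>R y"
  have w: "?w = z + t *\<^sub>R (y - z)" by (simp add: algebra_simps)
  have wU: "?w \<in> U" using U y z t by (simp add: convex_def)
  let ?E = "{(x, r::real). (g x + ind_fun U x) + ereal (\<beta> / 2 * (norm x)\<^sup>2) \<le> ereal r}"
  have cE: "convex ?E" using wc by (simp add: weakly_convex_modulus_on_def weakly_convex_modulus_def econvex_def)
  have mem: "(p, G p + \<beta> / 2 * (norm p)\<^sup>2) \<in> ?E" if "p \<in> U" for p
    using that fin by (simp add: ind_fun_def)
  have "(1 - t) *\<^sub>R (z, G z + \<beta> / 2 * (norm z)\<^sup>2) + t *\<^sub>R (y, G y + \<beta> / 2 * (norm y)\<^sup>2) \<in> ?E"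
    using t by (intro convexD[OF cE mem[OF z] mem[OF y]]) auto
  hence "G ?w + \<beta> / 2 * (norm ?w)\<^sup>2 \<le>
      (1 - t) * (G z + \<beta> / 2 * (norm z)\<^sup>2) + t * (G y + \<beta> / 2 * (norm y)\<^sup>2)"
    using fin[OF wU] wU by (simp add: ind_fun_def)
  moreover have nw: "(norm ?w)\<^sup>2 = (1 - t) * (norm z)\<^sup>2 + t * (norm y)\<^sup>2 - t * (1 - t) * (norm (y - z))\<^sup>2"
    unfolding power2_norm_eq_inner
    by (simp add: inner_add_left inner_add_right inner_diff_left inner_diff_right inner_commute
        algebra_simps)
  ultimately have "G ?w \<le> (1 - t) * G z + t * G y + \<beta> / 2 * t * (1 - t) * (norm (y - z))\<^sup>2"
    unfolding nw by (simp add: field_simps)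
  thus ?thesis unfolding w .
qed

text \<open>A Frechet subgradient controls \<open>g\<close> only near \<open>z\<close>. Using it at
  a segment point close to \<open>z\<close>, and bounding the value there by weak convexity, carries
  the estimate to every \<open>y\<close> in \<open>U\<close> after division by \<open>t\<close>; the
  slack \<open>e\<close> then tends to 0.\<close>

lemma weakly_convex_frechet_le:
  fixes g :: "'a::real_inner \<Rightarrow> ereal"
  assumes wc: "weakly_convex_modulus_on U g \<beta>" and U: "convex U" and fin: "\<And>y. y \<in> U \<Longrightarrow> g y = ereal (G y)"
    and y: "y \<in> U" and z: "z \<in> U" and v: "v \<in> frechet_subdiff g z"
  shows "G z + v \<bullet> (y - z) - \<beta> / 2 * (norm (y - z))\<^sup>2 \<le> G y"
proof (cases "y = z")
  case False
  have b: "\<beta> \<ge> 0" using wc by (simp add: weakly_convex_modulus_on_def weakly_convex_modulus_def)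
  let ?n = "norm (y - z)"
  have n: "?n > 0" using False by simp
  have main: "G z + v \<bullet> (y - z) - \<beta> / 2 * ?n\<^sup>2 \<le> G y + e * ?n" if e: "e > 0" for e
  proof -
    obtain d where d: "d > 0"
      "\<And>p. p \<noteq> z \<Longrightarrow> dist p z < d \<Longrightarrow> ereal (G z + v \<bullet> (p - z) - e * norm (p - z)) \<le> g p"
      using frechet_subdiffD[OF v fin[OF z] e] unfolding eventually_at by auto
    \<comment> \<open>Keeps the segment point within distance \<open>d / 2\<close> of
      \<open>z\<close>, and \<open>t\<close> at most 1.\<close>
    define t where "t = min 1 (d / (2 * ?n))"
    have t: "0 < t" "t \<le> 1" using d n by (auto simp: t_def)
    let ?p = "z + t *\<^sub>R (y - z)"
    have "t * ?n \<le> d / (2 * ?n) * ?n" by (intro mult_right_mono) (auto simp: t_def)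
    also have "\<dots> < d" using n d by simp
    finally have "dist ?p z < d" using t by (simp add: dist_norm)
    moreover have "?p \<noteq> z" using t False by simp
    moreover have pU: "?p \<in> U"
    proof -
      have "?p = (1 - t) *\<^sub>R z + t *\<^sub>R y" by (simp add: algebra_simps)
      thus ?thesis using U y z t by (simp add: convex_def)
    qed
    ultimately have "G z + v \<bullet> (?p - z) - e * norm (?p - z) \<le> G ?p"
      using d(2)[of ?p] fin[OF pU] by simp
    hence "G z + t * (v \<bullet> (y - z)) - e * (t * ?n) \<le> G ?p" using t by simp
    also have "\<dots> \<le> (1 - t) * G z + t * G y + \<beta> / 2 * t * (1 - t) * ?n\<^sup>2"
      using t by (intro weakly_convex_segment_le[OF wc U fin y z]) auto
    finally have "t * (G z + v \<bullet> (y - z) - e * ?n) \<le> t * (G y + \<beta> / 2 * (1 - t) * ?n\<^sup>2)"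
      by (simp add: algebra_simps)
    hence "G z + v \<bullet> (y - z) - e * ?n \<le> G y + \<beta> / 2 * (1 - t) * ?n\<^sup>2" using t by simp
    \<comment> \<open>Replacing \<open>1 - t\<close> by 1 removes \<open>t\<close>, which depends on
      \<open>e\<close> through \<open>d\<close>.\<close>
    moreover have "\<beta> / 2 * (1 - t) * ?n\<^sup>2 \<le> \<beta> / 2 * 1 * ?n\<^sup>2"
      using b t by (intro mult_right_mono mult_left_mono) auto
    ultimately show ?thesis by simp
  qed
  show ?thesis
  proof (rule field_le_epsilon)
    fix e :: real assume "e > 0"
    hence "e / ?n > 0" using n by simp
    from main[OF this] show "G z + v \<bullet> (y - z) - \<beta> / 2 * ?n\<^sup>2 \<le> G y + e" using n by simp
  qed
qed simp

text \<open>Openness of \<open>U\<close> puts the defining sequence eventually inside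
  \<open>U\<close>, where the Frechet inequality holds with the same \<open>\<beta>\<close>;
  convergence of points, values and subgradients lets it pass to the limit.\<close>

lemma weakly_convex_limiting_le:
  fixes g :: "'a::real_inner \<Rightarrow> ereal"
  assumes wc: "weakly_convex_modulus_on U g \<beta>" and U: "convex U" "open U"
    and fin: "\<And>y. y \<in> U \<Longrightarrow> g y = ereal (G y)"
    and y: "y \<in> U" and z: "z \<in> U" and v: "v \<in> limiting_subdiff g z"
  shows "G z + v \<bullet> (y - z) - \<beta> / 2 * (norm (y - z))\<^sup>2 \<le> G y"
proof -
  obtain xs vs where xs: "xs \<longlonglongrightarrow> z" and gx: "(\<lambda>n. g (xs n)) \<longlonglongrightarrow> g z"
    and vs: "\<And>n. vs n \<in> frechet_subdiff g (xs n)" "vs \<longlonglongrightarrow> v"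
    using v unfolding limiting_subdiff_def by blast
  have ev: "eventually (\<lambda>n. xs n \<in> U) sequentially" using xs U(2) z by (rule topological_tendstoD)
  have "(\<lambda>n. ereal (G (xs n))) \<longlonglongrightarrow> ereal (G z)"
    using gx unfolding fin[OF z] by (rule Lim_transform_eventually) (use ev fin in \<open>auto elim: eventually_mono\<close>)
  hence "(\<lambda>n. G (xs n) + vs n \<bullet> (y - xs n) - \<beta> / 2 * (norm (y - xs n))\<^sup>2)
      \<longlonglongrightarrow> G z + v \<bullet> (y - z) - \<beta> / 2 * (norm (y - z))\<^sup>2"
    using xs vs(2) by (intro tendsto_intros) auto
  moreover have "eventually (\<lambda>n. G (xs n) + vs n \<bullet> (y - xs n) - \<beta> / 2 * (norm (y - xs n))\<^sup>2 \<le> G y) sequentially"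
    using ev by eventually_elim (rule weakly_convex_frechet_le[OF wc U(1) fin y _ vs(1)])
  ultimately show ?thesis by (rule tendsto_upperbound) simp
qed

section \<open>One step of the algorithm\<close>

text \<open>The descent lemma: along the segment from \<open>x\<close> to \<open>y\<close>, the
  difference between \<open>h\<close> and its quadratic model has nonpositive derivative, by
  Cauchy-Schwarz and the Lipschitz bound on \<open>Dh\<close>.\<close>

lemma lipschitz_gradient_upper:
  fixes h :: "'b::real_inner \<Rightarrow> real"
  assumes h: "\<And>y. GDERIV h y :> Dh y" and L: "ell-lipschitz_on UNIV Dh"
  shows "h y \<le> h x + Dh x \<bullet> (y - x) + ell / 2 * (norm (y - x))\<^sup>2"
proof -
  let ?p = "y - x"
  let ?k = "\<lambda>t. h (x + t *\<^sub>R ?p) - t * (Dh x \<bullet> ?p) - ell / 2 * t\<^sup>2 * (norm ?p)\<^sup>2"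
  have "?k 1 \<le> ?k 0"
  proof (rule DERIV_nonpos_imp_nonincreasing[of 0 1 ?k])
    fix t :: real assume t: "0 \<le> t" "t \<le> 1"
    let ?D = "Dh (x + t *\<^sub>R ?p) \<bullet> ?p - Dh x \<bullet> ?p - ell * t * (norm ?p)\<^sup>2"
    have "(h has_derivative (\<lambda>d. d \<bullet> Dh (x + t *\<^sub>R ?p))) (at (x + t *\<^sub>R ?p))"
      using h by (simp add: gderiv_def)
    hence "((\<lambda>t. h (x + t *\<^sub>R ?p)) has_derivative (\<lambda>s. (s *\<^sub>R ?p) \<bullet> Dh (x + t *\<^sub>R ?p))) (at t)"
      by (rule has_derivative_compose[rotated]) (auto intro!: derivative_eq_intros)
    hence "((\<lambda>t. h (x + t *\<^sub>R ?p)) has_real_derivative (Dh (x + t *\<^sub>R ?p) \<bullet> ?p)) (at t)"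
      unfolding has_field_derivative_def
      by (rule has_derivative_eq_rhs) (simp add: fun_eq_iff inner_commute mult.commute)
    hence "(?k has_real_derivative ?D) (at t)"
      by (auto intro!: derivative_eq_intros)
    moreover have "?D \<le> 0"
    proof -
      have "(Dh (x + t *\<^sub>R ?p) - Dh x) \<bullet> ?p \<le> norm (Dh (x + t *\<^sub>R ?p) - Dh x) * norm ?p"
        by (rule norm_cauchy_schwarz)
      also have "\<dots> \<le> (ell * norm (t *\<^sub>R ?p)) * norm ?p"
        using lipschitz_onD[OF L, of "x + t *\<^sub>R ?p" x] by (intro mult_right_mono) (auto simp: dist_norm)
      also have "norm (t *\<^sub>R ?p) = t * norm ?p" using t by simp
      finally show ?thesis by (simp add: inner_diff_left power2_eq_square mult_ac)
    qed
    ultimately show "\<exists>y. (?k has_real_derivative y) (at t) \<and> y \<le> 0" by blast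
  qed simp
  thus ?thesis by simp
qed

lemma lipschitz_gradient_lower:
  fixes h :: "'b::real_inner \<Rightarrow> real"
  assumes h: "\<And>y. GDERIV h y :> Dh y" and L: "ell-lipschitz_on UNIV Dh"
  shows "h x + Dh x \<bullet> (y - x) - ell / 2 * (norm (y - x))\<^sup>2 \<le> h y"
proof -
  have "- h y \<le> - h x + (- Dh x) \<bullet> (y - x) + ell / 2 * (norm (y - x))\<^sup>2"
  proof (rule lipschitz_gradient_upper)
    show "GDERIV (\<lambda>y. - h y) y :> - Dh y" for y using h by (rule GDERIV_minus)
    show "ell-lipschitz_on UNIV (\<lambda>y. - Dh y)" using L by (simp add: lipschitz_on_minus)
  qed
  thus ?thesis by simp
qed

text \<open>Here \<open>w\<close> stands for the gradient at the extrapolated point and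
  \<open>q\<close> for the subgradient of \<open>g\<close>. Expanding the square splits off
  \<open>t / 2 * (norm (w - q))^2\<close>, which does not depend on \<open>y\<close> and cancels
  between the two sides.\<close>

lemma prox_step_argmin:
  fixes f :: "'a::real_inner \<Rightarrow> ereal"
  assumes x': "x' \<in> argmin_on C (\<lambda>y. f y + ereal (1 / (2 * t) * (norm (y - v + t *\<^sub>R w - t *\<^sub>R q))\<^sup>2))"
    and t: "t > 0"
  shows "x' \<in> C" "f x' < \<infinity>"
    "y \<in> C \<Longrightarrow> f x' + ereal ((w - q) \<bullet> (x' - y) + ((norm (x' - v))\<^sup>2 - (norm (y - v))\<^sup>2) / (2 * t)) \<le> f y"
proof -
  show "x' \<in> C" "f x' < \<infinity>" using x' by (auto simp: argmin_on_def is_arg_min_def)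
  have sq: "1 / (2 * t) * (norm (y - v + t *\<^sub>R w - t *\<^sub>R q))\<^sup>2
      = (norm (y - v))\<^sup>2 / (2 * t) + (w - q) \<bullet> (y - v) + t / 2 * (norm (w - q))\<^sup>2" for y
  proof -
    have "(norm (a + t *\<^sub>R b))\<^sup>2 = (norm a)\<^sup>2 + 2 * t * (b \<bullet> a) + t\<^sup>2 * (norm b)\<^sup>2" for a b :: 'a
      by (simp only: power2_norm_eq_inner) (simp add: inner_add_left inner_add_right inner_commute
          power2_eq_square algebra_simps)
    moreover have "y - v + t *\<^sub>R w - t *\<^sub>R q = (y - v) + t *\<^sub>R (w - q)" by (simp add: algebra_simps)
    ultimately have "(norm (y - v + t *\<^sub>R w - t *\<^sub>R q))\<^sup>2
        = (norm (y - v))\<^sup>2 + 2 * t * ((w - q) \<bullet> (y - v)) + t\<^sup>2 * (norm (w - q))\<^sup>2" by metis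
    thus ?thesis using t by (simp add: field_simps power2_eq_square)
  qed
  have shift: "a + ereal (p2 - q2 + (p1 - q1)) \<le> b"
    if "a + ereal (p1 + p2 + r) \<le> b + ereal (q1 + q2 + r)" "a < \<infinity>" for a b p1 p2 q1 q2 r
    using that by (cases a; cases b) auto
  assume "y \<in> C"
  hence "f x' + ereal (1 / (2 * t) * (norm (x' - v + t *\<^sub>R w - t *\<^sub>R q))\<^sup>2)
      \<le> f y + ereal (1 / (2 * t) * (norm (y - v + t *\<^sub>R w - t *\<^sub>R q))\<^sup>2)"
    using x' by (auto simp: argmin_on_def is_arg_min_def not_less)
  hence "f x' + ereal ((norm (x' - v))\<^sup>2 / (2 * t) + (w - q) \<bullet> (x' - v) + t / 2 * (norm (w - q))\<^sup>2)
      \<le> f y + ereal ((norm (y - v))\<^sup>2 / (2 * t) + (w - q) \<bullet> (y - v) + t / 2 * (norm (w - q))\<^sup>2)"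
    unfolding sq .
  from shift[OF this \<open>f x' < \<infinity>\<close>]
  show "f x' + ereal ((w - q) \<bullet> (x' - y) + ((norm (x' - v))\<^sup>2 - (norm (y - v))\<^sup>2) / (2 * t)) \<le> f y"
    by (simp add: diff_divide_distrib flip: inner_diff_right)
qed

text \<open>With \<open>P\<close> and \<open>Q\<close> the squared norms of the new step
  \<open>p\<close> and the previous step \<open>d\<close>, each product
  \<open>norm p * norm d\<close> is split into \<open>(P + Q) / 2\<close>. The \<open>Q\<close>
  halves add up to \<open>c * Q\<close>; the \<open>P\<close> halves, together with
  \<open>c * P\<close>, \<open>\<delta> * P\<close> and the curvature terms of \<open>h\<close> and
  \<open>g\<close>, are paid for by the proximal term \<open>1 / (2 * t) * P\<close>.\<close>

lemma extrapolated_step_descent: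
  fixes A :: "'a::euclidean_space \<Rightarrow> 'b::euclidean_space"
  assumes A: "linear A"
    and h: "\<And>y. GDERIV h y :> Dh y" "ell-lipschitz_on UNIV Dh"
    and g: "G x + q \<bullet> (x' - x) - \<beta> / 2 * (norm (x' - x))\<^sup>2 \<le> G x'"
    and t: "0 < t" "t * (\<beta> + 2 * \<delta> + ell * (onorm A)\<^sup>2 * (2 * lam_max + 1) + 2 * mu_max) \<le> 1"
    and la: "0 \<le> la" "la \<le> lam_max" and m: "0 \<le> m" "m \<le> mu_max * t"
    and c: "c = 1 / 2 * (ell * (onorm A)\<^sup>2 * lam_max + mu_max)"
    and step: "a + (adjoint A (Dh (A (x + la *\<^sub>R d))) - q) \<bullet> (x' - x)
        + ((norm (x' - (x + m *\<^sub>R d)))\<^sup>2 - (norm (x - (x + m *\<^sub>R d)))\<^sup>2) / (2 * t) \<le> b"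
  shows "a + h (A x') - G x' + c * (norm (x' - x))\<^sup>2 + \<delta> * (norm (x' - x))\<^sup>2
      \<le> b + h (A x) - G x + c * (norm d)\<^sup>2"
proof -
  have bl: "bounded_linear A" using A by (simp add: linear_conv_bounded_linear)
  have An: "norm (A z) \<le> onorm A * norm z" for z by (rule onorm[OF bl])
  have o: "onorm A \<ge> 0" by (rule onorm_pos_le[OF bl])
  have ell: "ell \<ge> 0" using h(2) by (rule lipschitz_on_nonneg)
  define p where "p = x' - x"
  define M where "M = ell * (onorm A)\<^sup>2"
  define P where "P = (norm p)\<^sup>2"
  define Q where "Q = (norm d)\<^sup>2"
  have M: "M \<ge> 0" using ell by (simp add: M_def)
  have P: "P \<ge> 0" and Q: "Q \<ge> 0" by (auto simp: P_def Q_def)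
  have pd: "norm p * norm d \<le> (P + Q) / 2"
    using sum_squares_bound[of "norm p" "norm d"] by (simp add: P_def Q_def)
  have Ap: "A x' - A x = A p" using A by (simp add: p_def linear_diff)
  have h1: "h (A x') \<le> h (A x) + Dh (A x) \<bullet> A p + M / 2 * P"
  proof -
    have "h (A x') \<le> h (A x) + Dh (A x) \<bullet> A p + ell / 2 * (norm (A p))\<^sup>2"
      using lipschitz_gradient_upper[OF h, of "A x'" "A x"] by (simp add: Ap)
    moreover have "ell / 2 * (norm (A p))\<^sup>2 \<le> ell / 2 * (onorm A * norm p)\<^sup>2"
      using ell An o by (intro mult_left_mono power_mono) auto
    ultimately show ?thesis by (simp add: M_def P_def power_mult_distrib)
  qed
  \<comment> \<open>The price of taking the gradient at the extrapolated point instead of at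
    \<open>x\<close>.\<close>
  have h2: "(Dh (A x) - Dh (A (x + la *\<^sub>R d))) \<bullet> A p \<le> M * lam_max * ((P + Q) / 2)"
  proof -
    have "(Dh (A x) - Dh (A (x + la *\<^sub>R d))) \<bullet> A p
        \<le> norm (Dh (A x) - Dh (A (x + la *\<^sub>R d))) * norm (A p)" by (rule norm_cauchy_schwarz)
    also have "\<dots> \<le> (ell * norm (A x - A (x + la *\<^sub>R d))) * norm (A p)"
      using lipschitz_onD[OF h(2), of "A x" "A (x + la *\<^sub>R d)"] by (intro mult_right_mono) (auto simp: dist_norm)
    also have "A x - A (x + la *\<^sub>R d) = - (la *\<^sub>R A d)" using A by (simp add: linear_add linear_scale)
    also have "(ell * norm (- (la *\<^sub>R A d))) * norm (A p) = (ell * la) * (norm (A d) * norm (A p))"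
      using la by simp
    also have "\<dots> \<le> (ell * la) * ((onorm A * norm d) * (onorm A * norm p))"
      using ell la An o by (intro mult_left_mono mult_mono) auto
    also have "\<dots> = (M * la) * (norm p * norm d)" by (simp add: M_def power2_eq_square)
    also have "\<dots> \<le> (M * lam_max) * ((P + Q) / 2)"
      using M la pd by (intro mult_mono mult_left_mono) auto
    finally show ?thesis .
  qed
  \<comment> \<open>Since \<open>m \<le> mu_max * t\<close>, the coefficient \<open>m / t\<close> is
    at most \<open>mu_max\<close>, however small the step size.\<close>
  have h3: "m / t * (p \<bullet> d) \<le> mu_max * ((P + Q) / 2)"
  proof -
    have "m / t * (p \<bullet> d) \<le> m / t * (norm p * norm d)"
      using m t norm_cauchy_schwarz by (intro mult_left_mono) auto
    also have "\<dots> \<le> mu_max * ((P + Q) / 2)"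
      using m t pd by (intro mult_mono) (auto simp: pos_divide_le_eq zero_le_mult_iff dest: order_trans)
    finally show ?thesis .
  qed
  have h4: "((norm (x' - (x + m *\<^sub>R d)))\<^sup>2 - (norm (x - (x + m *\<^sub>R d)))\<^sup>2) / (2 * t)
      = 1 / (2 * t) * P - m / t * (p \<bullet> d)"
  proof -
    have "x' - (x + m *\<^sub>R d) = p - m *\<^sub>R d" by (simp add: p_def)
    moreover have "x - (x + m *\<^sub>R d) = - (m *\<^sub>R d)" by simp
    ultimately have "(norm (x' - (x + m *\<^sub>R d)))\<^sup>2 - (norm (x - (x + m *\<^sub>R d)))\<^sup>2 = P - 2 * m * (p \<bullet> d)"
      by (simp only: P_def power2_norm_eq_inner)
        (simp add: inner_diff_left inner_diff_right inner_commute algebra_simps)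
    thus ?thesis using t by (simp add: field_simps)
  qed
  have h5: "(adjoint A (Dh (A (x + la *\<^sub>R d))) - q) \<bullet> (x' - x)
      = Dh (A (x + la *\<^sub>R d)) \<bullet> A p - q \<bullet> p"
    unfolding p_def[symmetric] by (metis adjoint_works[OF A] inner_commute inner_diff_left)
  \<comment> \<open>The step size bound is exactly the budget: \<open>\<beta> / 2\<close> for
    \<open>g\<close>, \<open>M / 2\<close> for \<open>h\<close>, \<open>\<delta>\<close> for the
    decrease, and \<open>M * lam_max\<close> and \<open>mu_max\<close> each as two halves, one from
    the cross terms and one from \<open>c * P\<close>.\<close>
  have "(\<beta> + 2 * \<delta> + M * (2 * lam_max + 1) + 2 * mu_max) / 2 \<le> 1 / (2 * t)"
    using t by (simp add: M_def field_simps)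
  hence "(\<beta> + 2 * \<delta> + M * (2 * lam_max + 1) + 2 * mu_max) / 2 * P \<le> 1 / (2 * t) * P"
    using P by (rule mult_right_mono)
  hence h6: "\<beta> / 2 * P + \<delta> * P + M * lam_max * P + M / 2 * P + mu_max * P \<le> 1 / (2 * t) * P"
    by (simp add: field_simps)
  have h7: "G x + q \<bullet> p - \<beta> / 2 * P \<le> G x'" using g by (simp add: p_def P_def)
  have c': "c * P = M * lam_max * P / 2 + mu_max * P / 2" "c * Q = M * lam_max * Q / 2 + mu_max * Q / 2"
    unfolding c M_def by (simp_all add: field_simps)
  have "a + h (A x') - G x' + c * P + \<delta> * P \<le> b + h (A x) - G x + c * Q"
    using step h1 h2 h3 h6 h7 unfolding h4 h5 c' by (simp add: inner_diff_left field_simps)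
  thus ?thesis by (simp add: P_def Q_def p_def)
qed

section \<open>Limits and differentiability\<close>

text \<open>Testing the inequality at distance \<open>s\<close> from \<open>z\<close> in the
  direction of \<open>q\<close> gives \<open>s * norm q \<le> 2 * B + K0 * s^2\<close>, where
  \<open>B\<close> bounds the absolute value of \<open>G\<close> on a compact ball around
  \<open>x\<close>.\<close>

lemma locally_bounded_quadratic_subgradients:
  fixes G :: "'a::euclidean_space \<Rightarrow> real"
  assumes U: "open U" and G: "continuous_on U G" and x: "x \<in> U"
  obtains e K where "e > 0"
    "\<And>z q. dist x z \<le> e \<Longrightarrow> (\<And>y. y \<in> U \<Longrightarrow> G z + q \<bullet> (y - z) - K0 * (norm (y - z))\<^sup>2 \<le> G y) \<Longrightarrow> norm q \<le> K"
proof -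
  obtain e where e: "e > 0" "cball x e \<subseteq> U" using U x open_contains_cball by blast
  have "compact (G ` cball x e)"
    using G e(2) by (intro compact_continuous_image) (auto intro: continuous_on_subset)
  then obtain B where B: "\<And>y. y \<in> cball x e \<Longrightarrow> \<bar>G y\<bar> \<le> B"
    using compact_imp_bounded bounded_iff by (metis image_eqI real_norm_def)
  \<comment> \<open>Half the radius, so that both \<open>z\<close> and the test point
    \<open>z + s *\<^sub>R p\<close> stay in the ball.\<close>
  define s where "s = e / 2"
  have s: "s > 0" using e by (simp add: s_def)
  have "norm q \<le> (2 * B + K0 * s\<^sup>2) / s"
    if z: "dist x z \<le> s" and q: "\<And>y. y \<in> U \<Longrightarrow> G z + q \<bullet> (y - z) - K0 * (norm (y - z))\<^sup>2 \<le> G y" for z q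
  proof -
    obtain p :: 'a where p: "norm p = 1" "q \<bullet> p = norm q"
    proof (cases "q = 0")
      case True
      show ?thesis by (rule that[of "SOME i. i \<in> Basis"]) (use True in \<open>simp_all add: norm_Basis SOME_Basis\<close>)
    next
      case False
      show ?thesis by (rule that[of "q /\<^sub>R norm q"])
          (use False in \<open>simp_all add: inner_commute power2_norm_eq_inner[symmetric] power2_eq_square\<close>)
    qed
    have "dist x (z + s *\<^sub>R p) \<le> dist x z + dist z (z + s *\<^sub>R p)" by (rule dist_triangle)
    also have "\<dots> \<le> s + s" using z p s by (simp add: dist_norm)
    finally have y: "z + s *\<^sub>R p \<in> cball x e" by (simp add: s_def)
    have zb: "z \<in> cball x e" using z e by (simp add: s_def)
    have "G z + q \<bullet> (s *\<^sub>R p) - K0 * (norm (s *\<^sub>R p))\<^sup>2 \<le> G (z + s *\<^sub>R p)"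
      using q[of "z + s *\<^sub>R p"] y e(2) by auto
    hence "s * norm q \<le> 2 * B + K0 * s\<^sup>2" using B[OF y] B[OF zb] p s by simp
    thus ?thesis using s by (simp add: field_simps)
  qed
  with s show ?thesis by (rule that)
qed

text \<open>\<open>Liminf (at x)\<close> ignores the point \<open>x\<close>, but \<open>s\<close>
  may take the value \<open>x\<close>; the assumption \<open>a < f x\<close> turns the punctured
  neighbourhood into a full one.\<close>

lemma lsc_eventually_less:
  assumes f: "lsc f" and a: "a < f x" and s: "(s \<longlongrightarrow> x) F"
  shows "eventually (\<lambda>k. a < f (s k)) F"
proof -
  have "a < Liminf (at x) f" using a f by (auto simp: lsc_def intro: less_le_trans)
  hence "eventually (\<lambda>y. a < f y) (at x)" by (rule less_LiminfD)
  hence "eventually (\<lambda>y. a < f y) (nhds x)" using a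
    by (simp add: eventually_nhds_conv_at)
  thus ?thesis using s by (rule eventually_compose_filterlim)
qed

lemma lsc_le_lim:
  fixes f :: "'a::topological_space \<Rightarrow> ereal"
  assumes f: "lsc f" and s: "(s \<longlongrightarrow> x) F" and le: "eventually (\<lambda>k. f (s k) \<le> ereal (u k)) F"
    and u: "(u \<longlongrightarrow> l) F" and F: "F \<noteq> bot"
  shows "f x \<le> ereal l"
proof (rule ccontr)
  assume "\<not> ?thesis"
  hence "ereal l < f x" by simp
  from ereal_dense2[OF this] obtain a where a: "ereal l < ereal a" "ereal a < f x" by auto
  have "eventually (\<lambda>k. ereal a < f (s k)) F" by (rule lsc_eventually_less[OF f a(2) s])
  moreover have "eventually (\<lambda>k. u k < a) F" using u a(1) by (intro order_tendstoD) auto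
  ultimately have "eventually (\<lambda>k. False) F" using le
  proof eventually_elim
    case (elim k)
    have "ereal a < ereal (u k)" using elim(1,3) by (rule less_le_trans)
    thus ?case using elim(2) by simp
  qed
  thus False using F by simp
qed

text \<open>Freezing the second variable at \<open>x\<close> in the two-point limit leaves ordinary
  differentiability, stated for the real values \<open>G\<close> without quotients.\<close>

lemma strictly_differentiable_imp_differentiable:
  fixes g :: "'a::real_inner \<Rightarrow> ereal"
  assumes g: "strictly_differentiable g x" and x: "g x = ereal (G x)"
    and fin: "eventually (\<lambda>y. g y = ereal (G y)) (at x)"
  obtains v where
    "\<And>e. e > 0 \<Longrightarrow> eventually (\<lambda>y. \<bar>G y - G x - v \<bullet> (y - x)\<bar> \<le> e * norm (y - x)) (at x)"
proof -
  obtain v where v: "((\<lambda>(y, z). (g y - g z - ereal (v \<bullet> (y - z))) / ereal (norm (y - z))) \<longlongrightarrow> 0)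
      (at (x, x) within {(y, z). y \<noteq> z})" using g unfolding strictly_differentiable_def by blast
  have "filterlim (\<lambda>y. (y, x)) (at (x, x) within {(y, z). y \<noteq> z}) (at x)"
    unfolding filterlim_at
  proof (intro conjI)
    show "((\<lambda>y. (y, x)) \<longlongrightarrow> (x, x)) (at x)" by (intro tendsto_intros)
    show "eventually (\<lambda>y. (y, x) \<in> {(y, z). y \<noteq> z} \<and> (y, x) \<noteq> (x, x)) (at x)"
      using eventually_neq_at_within[of x x UNIV] by eventually_elim simp
  qed
  from filterlim_compose[OF v this]
  have lim: "((\<lambda>y. (g y - g x - ereal (v \<bullet> (y - x))) / ereal (norm (y - x))) \<longlongrightarrow> 0) (at x)" by simp
  show ?thesis
  proof (rule that[of v])
    fix e :: real assume e: "e > 0"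
    have "eventually (\<lambda>y. ereal (-e) < (g y - g x - ereal (v \<bullet> (y - x))) / ereal (norm (y - x))) (at x)"
      "eventually (\<lambda>y. (g y - g x - ereal (v \<bullet> (y - x))) / ereal (norm (y - x)) < ereal e) (at x)"
      using e by (auto intro!: order_tendstoD[OF lim])
    moreover have "eventually (\<lambda>y. y \<noteq> x) (at x)" by (rule eventually_neq_at_within)
    ultimately show "eventually (\<lambda>y. \<bar>G y - G x - v \<bullet> (y - x)\<bar> \<le> e * norm (y - x)) (at x)"
      using fin
    proof eventually_elim
      case (elim y)
      hence n: "norm (y - x) > 0" by simp
      from elim x n have "-e < (G y - G x - v \<bullet> (y - x)) / norm (y - x)"
        "(G y - G x - v \<bullet> (y - x)) / norm (y - x) < e" by auto
      hence "- e * norm (y - x) < G y - G x - v \<bullet> (y - x)" "G y - G x - v \<bullet> (y - x) < e * norm (y - x)"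
        using n by (simp_all only: pos_less_divide_eq pos_divide_less_eq)
      thus ?case by simp
    qed
  qed
qed

text \<open>In the direction of \<open>v\<close> itself, the choice \<open>e = norm v / 2\<close>
  would give \<open>s * (norm v)^2 \<le> s * (norm v)^2 / 2\<close> for some
  \<open>s > 0\<close>.\<close>

lemma sublinear_functional_zero:
  fixes v x :: "'a::real_inner"
  assumes ev: "\<And>e. e > 0 \<Longrightarrow> eventually (\<lambda>y. v \<bullet> (y - x) \<le> e * norm (y - x)) (at x)"
  shows "v = 0"
proof (rule ccontr)
  assume v: "v \<noteq> 0"
  hence "norm v / 2 > 0" by simp
  from ev[OF this] obtain d where d: "d > 0"
    "\<And>y. y \<noteq> x \<Longrightarrow> dist y x < d \<Longrightarrow> v \<bullet> (y - x) \<le> norm v / 2 * norm (y - x)"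
    unfolding eventually_at by auto
  define s where "s = d / 2 / norm v"
  have s: "s > 0" using v d by (simp add: s_def)
  have "v \<bullet> (x + s *\<^sub>R v - x) \<le> norm v / 2 * norm (x + s *\<^sub>R v - x)"
    using v d(1) s by (intro d(2)) (auto simp: dist_norm s_def)
  moreover have "v \<bullet> (x + s *\<^sub>R v - x) = s * (norm v)\<^sup>2" by (simp add: power2_norm_eq_inner)
  moreover have "norm v / 2 * norm (x + s *\<^sub>R v - x) = s * (norm v)\<^sup>2 / 2"
    using s by (simp add: power2_eq_square)
  moreover have "s * (norm v)\<^sup>2 > 0" using s v by simp
  ultimately show False by linarith
qed

section \<open>Convergence\<close>

locale prox_subgrad =
  fixes C U :: "'a::euclidean_space set"
    and A :: "'a \<Rightarrow> 'b::euclidean_space"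
    and f g :: "'a \<Rightarrow> ereal"
    and h :: "'b \<Rightarrow> real"
    and Dh :: "'b \<Rightarrow> 'b"
    and ell \<beta> lam_max mu_max \<delta> c :: real
    and \<tau> lam \<mu> :: "nat \<Rightarrow> real"
    and gs x :: "nat \<Rightarrow> 'a"
    and F :: "'a \<Rightarrow> ereal"
  assumes C: "closed C"
    and A: "linear A"
    and f: "\<And>y. f y \<noteq> -\<infinity>" "lsc f"
    and h: "\<And>y. GDERIV h y :> Dh y" "ell-lipschitz_on UNIV Dh"
    and U: "open U" "convex U" "C \<subseteq> U"
    and g: "\<forall>y\<in>U. \<bar>g y\<bar> \<noteq> \<infinity>" "continuous_on U g" "weakly_convex_modulus_on U g \<beta>"
    and F_def: "F = objective f h A g"
    and params: "lam_max \<ge> 0" "mu_max \<ge> 0" "\<delta> > 0"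
    and alg: "prox_subgrad_extrapolation C f Dh ell A g \<beta> lam_max mu_max \<delta> \<tau> lam \<mu> gs x"
    and F_bounded_below: "\<exists>m::real. \<forall>y\<in>C. ereal m \<le> F y"
    and C0_bounded: "bounded {y \<in> C. F y \<le> F (x 0)}"
    and c_def: "c = 1 / 2 * (ell * (onorm A)\<^sup>2 * lam_max + mu_max)"
begin

text \<open>Real counterparts allow real arithmetic: \<open>G\<close> is faithful to
  \<open>g\<close> on \<open>U\<close>, and \<open>\<Phi> n\<close> to \<open>F (x n)\<close> for
  \<open>n \<ge> 1\<close>. \<open>F (x 0)\<close> may be infinite, and then \<open>\<Phi> 0\<close>
  is a default value.\<close>

definition G :: "'a \<Rightarrow> real" where "G y = real_of_ereal (g y)"
definition u :: "nat \<Rightarrow> 'a" where "u n = x n + lam n *\<^sub>R (x n - x (n - 1))"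
definition v :: "nat \<Rightarrow> 'a" where "v n = x n + \<mu> n *\<^sub>R (x n - x (n - 1))"
definition w :: "nat \<Rightarrow> 'a" where "w n = adjoint A (Dh (A (u n)))"
definition \<Phi> :: "nat \<Rightarrow> real" where "\<Phi> n = real_of_ereal (F (x n))"
definition step_bound :: real where
  "step_bound = 1 / (\<beta> + 2 * \<delta> + ell * (onorm A)\<^sup>2 * (2 * lam_max + 1) + 2 * mu_max)"

lemma g_eq: "y \<in> U \<Longrightarrow> g y = ereal (G y)"
  using g(1) by (simp add: G_def ereal_real)

lemma continuous_G: "continuous_on U G"
proof -
  have "continuous_on U (real_of_ereal \<circ> g)" using g(1,2) by (subst continuous_on_iff_real[symmetric]) auto
  thus ?thesis by (simp add: G_def[abs_def] o_def)
qed

lemma ell_nonneg: "ell \<ge> 0" using h(2) by (rule lipschitz_on_nonneg)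

lemma \<beta>_nonneg: "\<beta> \<ge> 0"
  using g(3) by (simp add: weakly_convex_modulus_on_def weakly_convex_modulus_def)

lemma c_nonneg: "c \<ge> 0" using ell_nonneg params by (simp add: c_def)

lemma \<tau>_bounds: "0 < \<tau> n" "\<tau> n \<le> step_bound"
  and lam_bounds: "0 \<le> lam n" "lam n \<le> lam_max"
  and \<mu>_bounds: "0 \<le> \<mu> n" "\<mu> n \<le> mu_max * \<tau> n"
  and gs_subgradient: "gs n \<in> limiting_subdiff g (x n)"
  and x_argmin: "x (Suc n) \<in> argmin_on C
      (\<lambda>y. f y + ereal (1 / (2 * \<tau> n) * (norm (y - v n + \<tau> n *\<^sub>R w n - \<tau> n *\<^sub>R gs n))\<^sup>2))"
  using alg unfolding prox_subgrad_extrapolation_def Let_def step_bound_def v_def w_def u_def by auto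

lemma \<tau>_step: "\<tau> n * (\<beta> + 2 * \<delta> + ell * (onorm A)\<^sup>2 * (2 * lam_max + 1) + 2 * mu_max) \<le> 1"
proof -
  have "0 < \<beta> + 2 * \<delta> + ell * (onorm A)\<^sup>2 * (2 * lam_max + 1) + 2 * mu_max"
    using \<beta>_nonneg ell_nonneg params by (intro add_pos_nonneg add_nonneg_pos mult_nonneg_nonneg) auto
  thus ?thesis using \<tau>_bounds(2)[of n] by (simp add: step_bound_def pos_le_divide_eq)
qed

lemma x_in_C: "x n \<in> C"
proof (cases n)
  case 0
  thus ?thesis using alg by (simp add: prox_subgrad_extrapolation_def)
next
  case (Suc k)
  thus ?thesis using prox_step_argmin(1)[OF x_argmin \<tau>_bounds(1)] by simp
qed

lemma x_in_U: "x n \<in> U" using x_in_C U(3) by blast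

text \<open>The index starts at \<open>Suc n\<close>: membership in \<open>argmin_on\<close> forces
  a finite value, whereas \<open>x 0\<close> is merely a point of \<open>C\<close> and may lie
  outside the domain of \<open>f\<close>.\<close>

lemma f_finite: "\<bar>f (x (Suc n))\<bar> \<noteq> \<infinity>"
  using prox_step_argmin(2)[OF x_argmin[of n] \<tau>_bounds(1)] f(1) by (cases "f (x (Suc n))") auto

lemmas prox_le = prox_step_argmin(3)[OF x_argmin \<tau>_bounds(1)]

lemma subgradient_le:
  "y \<in> U \<Longrightarrow> G (x n) + gs n \<bullet> (y - x n) - \<beta> / 2 * (norm (y - x n))\<^sup>2 \<le> G y"
  by (rule weakly_convex_limiting_le[OF g(3) U(2,1) g_eq _ x_in_U gs_subgradient])

lemma F_eq: "y \<in> U \<Longrightarrow> F y = f y + ereal (h (A y) - G y)"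
  by (cases "f y") (simp_all add: F_def objective_def g_eq)

lemma F_real: "F (x (Suc n)) = ereal (\<Phi> (Suc n))"
proof -
  have "\<bar>F (x (Suc n))\<bar> \<noteq> \<infinity>" using f_finite[of n] by (cases "f (x (Suc n))") (auto simp: F_eq x_in_U)
  thus ?thesis by (simp add: \<Phi>_def ereal_real)
qed

lemma F_decrease:
  "F (x (Suc n)) + ereal (c * (norm (x (Suc n) - x n))\<^sup>2) + ereal (\<delta> * (norm (x (Suc n) - x n))\<^sup>2)
     \<le> F (x n) + ereal (c * (norm (x n - x (n - 1)))\<^sup>2)"
proof (cases "f (x n)")
  case MInf
  thus ?thesis using f(1) by simp
next
  \<comment> \<open>Possible only for \<open>n = 0\<close>; the right-hand side is then
    infinite.\<close>
  case PInf
  thus ?thesis by (simp add: F_eq x_in_U)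
next
  case (real b)
  obtain a where a: "f (x (Suc n)) = ereal a" using f_finite[of n] by (cases "f (x (Suc n))") auto
  have "a + (w n - gs n) \<bullet> (x (Suc n) - x n)
      + ((norm (x (Suc n) - v n))\<^sup>2 - (norm (x n - v n))\<^sup>2) / (2 * \<tau> n) \<le> b"
    using prox_le[of "x n" n] x_in_C real a by (simp add: add.assoc)
  hence "a + h (A (x (Suc n))) - G (x (Suc n)) + c * (norm (x (Suc n) - x n))\<^sup>2
      + \<delta> * (norm (x (Suc n) - x n))\<^sup>2
      \<le> b + h (A (x n)) - G (x n) + c * (norm (x n - x (n - 1)))\<^sup>2"
    unfolding w_def u_def v_def
    by (rule extrapolated_step_descent[where G = G and x = "x n" and q = "gs n" and x' = "x (Suc n)", OF A h subgradient_le[OF x_in_U] \<tau>_bounds(1) \<tau>_step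
          lam_bounds \<mu>_bounds c_def])
  thus ?thesis using a real by (simp add: F_eq x_in_U)
qed

section \<open>Decreasing energy and vanishing steps\<close>

text \<open>The Lyapunov function of the method, shifted by one index so that it involves only
  finite values of \<open>F\<close>.\<close>

definition E :: "nat \<Rightarrow> real" where
  "E n = \<Phi> (Suc n) + c * (norm (x (Suc n) - x n))\<^sup>2"

lemma E_decrease: "E (Suc n) + \<delta> * (norm (x (Suc (Suc n)) - x (Suc n)))\<^sup>2 \<le> E n"
  using F_decrease[of "Suc n"] by (simp add: F_real E_def)

lemma decseq_E: "decseq E"
proof (rule decseq_SucI)
  fix n
  have "0 \<le> \<delta> * (norm (x (Suc (Suc n)) - x (Suc n)))\<^sup>2" using params by simp
  thus "E (Suc n) \<le> E n" using E_decrease[of n] by linarith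
qed

lemma E_convergent: obtains L where "E \<longlonglongrightarrow> L"
proof -
  obtain m where m: "\<And>y. y \<in> C \<Longrightarrow> ereal m \<le> F y" using F_bounded_below by blast
  have "m \<le> E n" for n
  proof -
    have "m \<le> \<Phi> (Suc n)" using m[OF x_in_C[of "Suc n"]] by (simp add: F_real)
    moreover have "0 \<le> c * (norm (x (Suc n) - x n))\<^sup>2" using c_nonneg by simp
    ultimately show ?thesis unfolding E_def by linarith
  qed
  thus ?thesis using decseq_convergent[OF decseq_E] that by metis
qed

text \<open>The squared step is at most the difference of consecutive values of the convergent
  sequence \<open>E\<close>, divided by \<open>\<delta>\<close>.\<close>

lemma steps_tendsto_0: "(\<lambda>n. x (Suc n) - x n) \<longlonglongrightarrow> 0"
proof -
  obtain L where L: "E \<longlonglongrightarrow> L" by (rule E_convergent)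
  have "(\<lambda>n. (E n - E (Suc n)) / \<delta>) \<longlonglongrightarrow> (L - L) / \<delta>"
    using L LIMSEQ_Suc[OF L] params by (intro tendsto_intros) auto
  hence lim: "(\<lambda>n. (E n - E (Suc n)) / \<delta>) \<longlonglongrightarrow> 0" by simp
  have "(\<lambda>n. (norm (x (Suc (Suc n)) - x (Suc n)))\<^sup>2) \<longlonglongrightarrow> 0"
  proof (rule tendsto_sandwich[OF _ _ tendsto_const lim])
    show "eventually (\<lambda>n. (norm (x (Suc (Suc n)) - x (Suc n)))\<^sup>2 \<le> (E n - E (Suc n)) / \<delta>) sequentially"
      using E_decrease params by (intro always_eventually) (simp add: pos_le_divide_eq algebra_simps)
  qed simp
  hence "(\<lambda>n. sqrt ((norm (x (Suc (Suc n)) - x (Suc n)))\<^sup>2)) \<longlonglongrightarrow> sqrt 0" by (rule tendsto_real_sqrt)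
  hence "(\<lambda>n. x (Suc (Suc n)) - x (Suc n)) \<longlonglongrightarrow> 0" by (simp add: tendsto_norm_zero_iff)
  thus ?thesis by (subst (asm) filterlim_sequentially_Suc)
qed

lemma F_convergent: obtains L where "(\<lambda>n. F (x n)) \<longlonglongrightarrow> ereal L"
proof -
  obtain L where L: "E \<longlonglongrightarrow> L" by (rule E_convergent)
  have "(\<lambda>n. E n - c * (norm (x (Suc n) - x n))\<^sup>2) \<longlonglongrightarrow> L - c * (norm (0::'a))\<^sup>2"
    by (intro tendsto_intros L steps_tendsto_0)
  hence "(\<lambda>n. \<Phi> (Suc n)) \<longlonglongrightarrow> L" by (simp add: E_def)
  hence "(\<lambda>n. F (x (Suc n))) \<longlonglongrightarrow> ereal L" by (simp add: F_real)
  thus ?thesis using that by (subst (asm) filterlim_sequentially_Suc)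
qed

text \<open>The values of \<open>F\<close> along the iterates need not decrease, but
  \<open>E\<close> does and dominates them. This places every iterate in the bounded sublevel
  set.\<close>

lemma F_le_start: "F (x n) \<le> F (x 0)"
proof (cases n)
  case (Suc k)
  have "\<Phi> (Suc k) \<le> E k" using c_nonneg by (simp add: E_def)
  also have "E k \<le> E 0" using decseq_E by (simp add: decseq_def)
  finally have "F (x n) \<le> ereal (E 0)" using Suc by (simp add: F_real)
  also have "ereal (E 0) \<le> ereal (E 0 + \<delta> * (norm (x (Suc 0) - x 0))\<^sup>2)" using params by simp
  \<comment> \<open>At \<open>n = 0\<close> truncated subtraction gives
    \<open>x 0 - x (0 - 1) = 0\<close>, so nothing is added to \<open>F (x 0)\<close>.\<close>
  also have "\<dots> \<le> F (x 0)" using F_decrease[of 0] by (simp add: F_real E_def zero_ereal_def[symmetric])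
  finally show ?thesis .
qed simp

lemma bounded_x: "bounded (range x)"
  using x_in_C F_le_start by (intro bounded_subset[OF C0_bounded]) auto

section \<open>Limits along subsequences\<close>

text \<open>Bounded multiples of vanishing steps do not move the limit; used with \<open>lam\<close>
  for \<open>u\<close> and with \<open>\<mu>\<close> for \<open>v\<close>.\<close>

lemma extrapolation_tendsto:
  assumes s: "strict_mono s" "(x \<circ> s) \<longlonglongrightarrow> xb"
    and a: "\<And>n. 0 \<le> a n" "\<And>n. a n \<le> a_max"
  shows "(\<lambda>k. x (s k) + a (s k) *\<^sub>R (x (s k) - x (s k - 1))) \<longlonglongrightarrow> xb"
proof -
  have "(\<lambda>n. x n - x (n - 1)) \<longlonglongrightarrow> 0"
    using steps_tendsto_0 by (subst filterlim_sequentially_Suc[symmetric]) simp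
  hence "(\<lambda>n. a_max * norm (x n - x (n - 1))) \<longlonglongrightarrow> a_max * norm (0::'a)"
    by (intro tendsto_intros)
  hence "(\<lambda>n. a_max * norm (x n - x (n - 1))) \<longlonglongrightarrow> 0" by simp
  hence "(\<lambda>n. a n *\<^sub>R (x n - x (n - 1))) \<longlonglongrightarrow> 0"
    by (rule Lim_null_comparison[rotated])
      (use a in \<open>auto intro!: always_eventually mult_right_mono\<close>)
  hence "(\<lambda>k. a (s k) *\<^sub>R (x (s k) - x (s k - 1))) \<longlonglongrightarrow> 0"
    using LIMSEQ_subseq_LIMSEQ[OF _ s(1)] by (fastforce simp: o_def)
  from tendsto_add[OF s(2) this] show ?thesis by (simp add: o_def)
qed

text \<open>Near \<open>xb\<close> the vectors \<open>gs n\<close> satisfy quadratic subgradient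
  inequalities with the same constant, hence are bounded, and Bolzano-Weierstrass applies.\<close>

lemma convergent_subgradients:
  assumes r: "strict_mono r" "(x \<circ> r) \<longlonglongrightarrow> xb" and xb: "xb \<in> U"
  obtains s q where "strict_mono s" "(x \<circ> s) \<longlonglongrightarrow> xb" "(gs \<circ> s) \<longlonglongrightarrow> q"
proof -
  obtain e K where e: "e > 0" and K: "\<And>z q. dist xb z \<le> e \<Longrightarrow>
      (\<And>y. y \<in> U \<Longrightarrow> G z + q \<bullet> (y - z) - \<beta> / 2 * (norm (y - z))\<^sup>2 \<le> G y) \<Longrightarrow> norm q \<le> K"
    using locally_bounded_quadratic_subgradients[OF U(1) continuous_G xb] by metis
  obtain N where N: "\<And>k. k \<ge> N \<Longrightarrow> dist (x (r k)) xb < e"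
    using r(2) e unfolding lim_sequentially o_def by blast
  \<comment> \<open>The shift by \<open>N\<close> leaves only iterates in the ball where the bound
    \<open>K\<close> applies.\<close>
  have "bounded (range (\<lambda>k. gs (r (k + N))))"
    unfolding bounded_iff
  proof (intro exI ballI)
    fix q assume "q \<in> range (\<lambda>k. gs (r (k + N)))"
    then obtain k where k: "q = gs (r (k + N))" by blast
    show "norm q \<le> K" unfolding k
      using N[of "k + N"] by (intro K[OF _ subgradient_le]) (simp_all add: dist_commute)
  qed
  then obtain q s where s: "strict_mono s" "((\<lambda>k. gs (r (k + N))) \<circ> s) \<longlonglongrightarrow> q"
    using bounded_imp_convergent_subsequence by blast
  show ?thesis
  proof (rule that)
    show m: "strict_mono (\<lambda>k. r (s k + N))" using r(1) s(1) by (simp add: strict_mono_def)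
    show "(gs \<circ> (\<lambda>k. r (s k + N))) \<longlonglongrightarrow> q" using s(2) by (simp add: o_def)
    have "strict_mono (\<lambda>k. s k + N)" using s(1) by (simp add: strict_mono_def)
    from LIMSEQ_subseq_LIMSEQ[OF r(2) this] show "(x \<circ> (\<lambda>k. r (s k + N))) \<longlonglongrightarrow> xb" by (simp add: o_def)
  qed
qed

lemma continuous_adjoint_gradient: "continuous_on UNIV (\<lambda>y. adjoint A (Dh (A y)))"
proof -
  have Dh: "continuous_on UNIV Dh" using h(2) by (rule lipschitz_on_continuous_on)
  have "continuous_on UNIV A" "continuous_on UNIV (adjoint A)"
    using A adjoint_linear[OF A] by (auto intro: linear_continuous_on simp: linear_conv_bounded_linear)
  from continuous_on_compose2[OF this(2) continuous_on_compose2[OF Dh this(1)]] show ?thesis by simp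
qed

lemma continuous_h: "continuous_on UNIV h"
  using h(1) by (auto simp: gderiv_def intro!: continuous_at_imp_continuous_on has_derivative_continuous)

text \<open>\<open>q\<close> is a limit of the vectors \<open>gs\<close> along a subsequence. The
  last two inequalities are limits of \<open>prox_le\<close> and \<open>subgradient_le\<close>
  tested at a fixed \<open>y\<close>.\<close>

lemma cluster_point_inequalities:
  assumes tau: "liminf (\<lambda>n. ereal (\<tau> n)) = ereal t" "t > 0"
    and r: "strict_mono r" "(x \<circ> r) \<longlonglongrightarrow> xb"
  obtains q where "xb \<in> C" "f xb < \<infinity>" "(\<lambda>n. F (x n)) \<longlonglongrightarrow> F xb"
    "\<And>y. y \<in> C \<Longrightarrow>
      f xb + ereal ((adjoint A (Dh (A xb)) - q) \<bullet> (xb - y) - (norm (y - xb))\<^sup>2 / t) \<le> f y"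
    "\<And>y. y \<in> U \<Longrightarrow> G xb + q \<bullet> (y - xb) - \<beta> / 2 * (norm (y - xb))\<^sup>2 \<le> G y"
proof -
  have xbC: "xb \<in> C" by (rule closed_sequentially[OF C _ r(2)]) (simp add: x_in_C)
  hence xbU: "xb \<in> U" using U(3) by blast
  obtain s q where s: "strict_mono s" and xs: "(x \<circ> s) \<longlonglongrightarrow> xb" and qs: "(gs \<circ> s) \<longlonglongrightarrow> q"
    using convergent_subgradients[OF r xbU] .
  have us: "(\<lambda>k. u (s k)) \<longlonglongrightarrow> xb"
    unfolding u_def by (rule extrapolation_tendsto[OF s xs lam_bounds])
  \<comment> \<open>The bound on \<open>\<mu> n\<close> varies with \<open>\<tau> n\<close>; the
    upper bound on the step sizes makes it uniform.\<close>
  have "\<mu> n \<le> mu_max * step_bound" for n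
    using \<mu>_bounds(2)[of n] mult_left_mono[OF \<tau>_bounds(2)[of n] params(2)] by linarith
  hence vs: "(\<lambda>k. v (s k)) \<longlonglongrightarrow> xb"
    unfolding v_def by (rule extrapolation_tendsto[OF s xs \<mu>_bounds(1)])
  have ws: "(\<lambda>k. w (s k)) \<longlonglongrightarrow> adjoint A (Dh (A xb))"
    unfolding w_def by (rule continuous_on_tendsto_compose[OF continuous_adjoint_gradient us]) auto
  have "(\<lambda>k. x (Suc (s k)) - x (s k)) \<longlonglongrightarrow> 0"
    using LIMSEQ_subseq_LIMSEQ[OF steps_tendsto_0 s] by (simp add: o_def)
  from tendsto_add[OF xs this] have xS: "(\<lambda>k. x (Suc (s k))) \<longlonglongrightarrow> xb" by (simp add: o_def)
  have "ereal (t / 2) < liminf (\<lambda>n. ereal (\<tau> n))" using tau by simp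
  hence "eventually (\<lambda>n. t / 2 < \<tau> n) sequentially" by (auto dest: less_LiminfD)
  hence evt: "eventually (\<lambda>k. t / 2 < \<tau> (s k)) sequentially"
    by (rule eventually_subseq[OF s])
  \<comment> \<open>A lower estimate of the real term in \<open>prox_le\<close>: a nonnegative
    square is dropped and \<open>1 / (2 * \<tau> (s k))\<close> is replaced by the eventual upper
    bound \<open>1 / t\<close>. This removes the step sizes, which need not converge.\<close>
  define e where "e y k = (w (s k) - gs (s k)) \<bullet> (x (Suc (s k)) - y) - (norm (y - v (s k)))\<^sup>2 / t" for y k
  define eb where "eb y = (adjoint A (Dh (A xb)) - q) \<bullet> (xb - y) - (norm (y - xb))\<^sup>2 / t" for y
  have e_lim: "e y \<longlonglongrightarrow> eb y" for y
    unfolding e_def eb_def using qs ws xS vs tau(2)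
    by (intro tendsto_intros) (auto simp: o_def)
  have step: "eventually (\<lambda>k. f (x (Suc (s k))) + ereal (e y k) \<le> f y) sequentially" if y: "y \<in> C" for y
    using evt
  proof eventually_elim
    case (elim k)
    have "(norm (y - v (s k)))\<^sup>2 / (2 * \<tau> (s k)) \<le> (norm (y - v (s k)))\<^sup>2 / t"
      using elim tau(2) by (intro divide_left_mono) auto
    moreover have "0 \<le> (norm (x (Suc (s k)) - v (s k)))\<^sup>2 / (2 * \<tau> (s k))"
      using \<tau>_bounds(1)[of "s k"] by simp
    ultimately have "e y k \<le> (w (s k) - gs (s k)) \<bullet> (x (Suc (s k)) - y)
        + ((norm (x (Suc (s k)) - v (s k)))\<^sup>2 - (norm (y - v (s k)))\<^sup>2) / (2 * \<tau> (s k))"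
      by (simp add: e_def diff_divide_distrib)
    hence "f (x (Suc (s k))) + ereal (e y k) \<le> f (x (Suc (s k)))
        + ereal ((w (s k) - gs (s k)) \<bullet> (x (Suc (s k)) - y)
        + ((norm (x (Suc (s k)) - v (s k)))\<^sup>2 - (norm (y - v (s k)))\<^sup>2) / (2 * \<tau> (s k)))"
      by (intro add_left_mono) simp
    also have "\<dots> \<le> f y" by (rule prox_le[OF y])
    finally show ?case .
  qed
  have lim_le: "f xb + ereal (eb y) \<le> f y" if y: "y \<in> C" for y
  proof (cases "f y")
    case (real b)
    have "f xb \<le> ereal (b - eb y)"
    proof (rule lsc_le_lim[OF f(2) xS])
      show "eventually (\<lambda>k. f (x (Suc (s k))) \<le> ereal (b - e y k)) sequentially"
        using step[OF y]
      proof eventually_elim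
        case (elim k)
        thus ?case using real by (cases "f (x (Suc (s k)))") auto
      qed
      show "(\<lambda>k. b - e y k) \<longlonglongrightarrow> b - eb y" by (intro tendsto_intros e_lim)
    qed simp
    thus ?thesis using real by (cases "f xb") auto
  next
    case MInf
    thus ?thesis using f(1) by simp
  qed simp
  \<comment> \<open>The test point \<open>x 1\<close> lies in the domain of
    \<open>f\<close>.\<close>
  have "f xb < \<infinity>" using lim_le[OF x_in_C[of 1]] f_finite[of 0] by (cases "f xb") auto
  then obtain fb where fb: "f xb = ereal fb" using f(1) by (cases "f xb") auto
  \<comment> \<open>Lower semicontinuity gives the lower half; the upper half is the proximal
    inequality tested at \<open>y = xb\<close>, where \<open>eb xb = 0\<close>.\<close>
  have "(\<lambda>k. f (x (Suc (s k)))) \<longlonglongrightarrow> f xb"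
  proof (rule order_tendstoI)
    fix a assume "a < f xb"
    thus "eventually (\<lambda>k. a < f (x (Suc (s k)))) sequentially" using xS by (rule lsc_eventually_less[OF f(2)])
  next
    fix a assume a: "f xb < a"
    have "(\<lambda>k. ereal (fb - e xb k)) \<longlonglongrightarrow> ereal (fb - eb xb)" by (intro tendsto_intros e_lim)
    hence "eventually (\<lambda>k. ereal (fb - e xb k) < a) sequentially"
      using a fb by (intro order_tendstoD(2)) (simp_all add: eb_def)
    with step[OF xbC] show "eventually (\<lambda>k. f (x (Suc (s k))) < a) sequentially"
    proof eventually_elim
      case (elim k)
      have "f (x (Suc (s k))) \<le> ereal (fb - e xb k)"
        using elim(1) fb by (cases "f (x (Suc (s k)))") auto
      thus ?case using elim(2) by (rule le_less_trans)
    qed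
  qed
  moreover have "(\<lambda>k. h (A (x (Suc (s k)))) - G (x (Suc (s k)))) \<longlonglongrightarrow> h (A xb) - G xb"
  proof (intro tendsto_intros)
    have "continuous_on UNIV A" using A by (auto intro: linear_continuous_on simp: linear_conv_bounded_linear)
    hence "(\<lambda>k. A (x (Suc (s k)))) \<longlonglongrightarrow> A xb" by (rule continuous_on_tendsto_compose[OF _ xS]) auto
    thus "(\<lambda>k. h (A (x (Suc (s k))))) \<longlonglongrightarrow> h (A xb)"
      by (rule continuous_on_tendsto_compose[OF continuous_h]) auto
    show "(\<lambda>k. G (x (Suc (s k)))) \<longlonglongrightarrow> G xb"
      by (rule continuous_on_tendsto_compose[OF continuous_G xS xbU]) (simp add: x_in_U)
  qed
  ultimately have "(\<lambda>k. f (x (Suc (s k))) + ereal (h (A (x (Suc (s k)))) - G (x (Suc (s k)))))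
      \<longlonglongrightarrow> f xb + ereal (h (A xb) - G xb)"
    using fb by (intro tendsto_add_ereal_general) auto
  hence FS: "(\<lambda>k. F (x (Suc (s k)))) \<longlonglongrightarrow> F xb" by (simp add: F_eq x_in_U xbU)
  \<comment> \<open>The whole sequence of values converges, so the subsequence identifies its
    limit.\<close>
  obtain L where L: "(\<lambda>n. F (x n)) \<longlonglongrightarrow> ereal L" by (rule F_convergent)
  have "strict_mono (\<lambda>k. Suc (s k))" using s by (simp add: strict_mono_def)
  from LIMSEQ_subseq_LIMSEQ[OF L this] have "(\<lambda>k. F (x (Suc (s k)))) \<longlonglongrightarrow> ereal L" by (simp add: o_def)
  from LIMSEQ_unique[OF this FS] L have FL: "(\<lambda>n. F (x n)) \<longlonglongrightarrow> F xb" by simp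
  have sub: "G xb + q \<bullet> (y - xb) - \<beta> / 2 * (norm (y - xb))\<^sup>2 \<le> G y" if y: "y \<in> U" for y
  proof (rule tendsto_upperbound)
    have "(\<lambda>k. G (x (s k))) \<longlonglongrightarrow> G xb"
      using xs by (intro continuous_on_tendsto_compose[OF continuous_G _ xbU]) (auto simp: x_in_U o_def)
    thus "(\<lambda>k. G (x (s k)) + gs (s k) \<bullet> (y - x (s k)) - \<beta> / 2 * (norm (y - x (s k)))\<^sup>2)
        \<longlonglongrightarrow> G xb + q \<bullet> (y - xb) - \<beta> / 2 * (norm (y - xb))\<^sup>2"
      using xs qs by (intro tendsto_intros) (auto simp: o_def)
    show "eventually (\<lambda>k. G (x (s k)) + gs (s k) \<bullet> (y - x (s k))
        - \<beta> / 2 * (norm (y - x (s k)))\<^sup>2 \<le> G y) sequentially"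
      using subgradient_le[OF y] by (intro always_eventually) simp
  qed simp
  show ?thesis
    by (rule that[OF xbC \<open>f xb < \<infinity>\<close> FL lim_le[unfolded eb_def] sub])
qed

section \<open>Stationarity of cluster points\<close>

lemma quadratic_subgradients_imp_lifted_stationary:
  assumes xb: "xb \<in> C" "f xb < \<infinity>"
    and fq: "\<And>y. y \<in> C \<Longrightarrow>
      f xb + ereal ((adjoint A (Dh (A xb)) - q) \<bullet> (xb - y) - (norm (y - xb))\<^sup>2 / t) \<le> f y"
    and gq: "\<And>y. y \<in> U \<Longrightarrow> G xb + q \<bullet> (y - xb) - \<beta> / 2 * (norm (y - xb))\<^sup>2 \<le> G y"
  shows "lifted_stationary_point C f Dh A g xb"
proof -
  let ?p = "q - adjoint A (Dh (A xb))"
  have xbU: "xb \<in> U" using xb U(3) by blast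
  obtain fb where fb: "f xb = ereal fb" using xb f(1) by (cases "f xb") auto
  have "?p \<in> frechet_subdiff (\<lambda>y. f y + ind_fun C y) xb"
  proof (rule frechet_subdiff_quadraticI)
    show "f xb + ind_fun C xb = ereal fb" using xb fb by (simp add: ind_fun_def)
    have "ereal (fb + ?p \<bullet> (y - xb) - 1 / t * (norm (y - xb))\<^sup>2) \<le> f y + ind_fun C y" for y
    proof (cases "y \<in> C")
      case True
      have "(adjoint A (Dh (A xb)) - q) \<bullet> (xb - y) = ?p \<bullet> (y - xb)"
        by (simp add: inner_diff_left inner_diff_right)
      thus ?thesis using fq[OF True] fb True by (simp add: ind_fun_def algebra_simps)
    next
      case False
      thus ?thesis using f(1)[of y] by (simp add: ind_fun_def)
    qed
    thus "eventually (\<lambda>y. ereal (fb + ?p \<bullet> (y - xb) - 1 / t * (norm (y - xb))\<^sup>2) \<le> f y + ind_fun C y) (at xb)"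
      by (intro always_eventually) simp
  qed
  hence "?p \<in> limiting_subdiff (\<lambda>y. f y + ind_fun C y) xb" using frechet_subset_limiting by blast
  moreover have "q \<in> frechet_subdiff g xb"
  proof (rule frechet_subdiff_quadraticI[where r = "G xb"])
    show "g xb = ereal (G xb)" by (rule g_eq[OF xbU])
    show "eventually (\<lambda>y. ereal (G xb + q \<bullet> (y - xb) - \<beta> / 2 * (norm (y - xb))\<^sup>2) \<le> g y) (at xb)"
      using eventually_at_in_open'[OF U(1) xbU] by eventually_elim (simp only: g_eq ereal_less_eq gq)
  qed
  hence "q \<in> limiting_subdiff g xb" using frechet_subset_limiting by blast
  moreover have "0 = ?p + adjoint A (Dh (A xb)) - q" by simp
  ultimately show ?thesis unfolding lifted_stationary_point_def using xb(1) by blast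
qed

text \<open>Differentiability makes \<open>q\<close> the gradient of \<open>g\<close>, so that
  \<open>- g\<close> has a first-order lower estimate with slope \<open>- q\<close>. The slopes from
  \<open>f\<close> with the indicator, from \<open>h\<close> after \<open>A\<close>, and from
  \<open>- g\<close> then sum to 0.\<close>

lemma quadratic_subgradients_imp_stationary:
  assumes xb: "xb \<in> C" "f xb < \<infinity>"
    and fq: "\<And>y. y \<in> C \<Longrightarrow>
      f xb + ereal ((adjoint A (Dh (A xb)) - q) \<bullet> (xb - y) - (norm (y - xb))\<^sup>2 / t) \<le> f y"
    and gq: "\<And>y. y \<in> U \<Longrightarrow> G xb + q \<bullet> (y - xb) - \<beta> / 2 * (norm (y - xb))\<^sup>2 \<le> G y"
    and sd: "strictly_differentiable g xb"
  shows "stationary_point C f h A g xb"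
proof -
  have xbU: "xb \<in> U" using xb U(3) by blast
  obtain fb where fb: "f xb = ereal fb" using xb f(1) by (cases "f xb") auto
  have evU: "eventually (\<lambda>y. y \<in> U) (at xb)" by (rule eventually_at_in_open'[OF U(1) xbU])
  have ev_g: "eventually (\<lambda>y. g y = ereal (G y)) (at xb)" using evU by eventually_elim (rule g_eq)
  obtain z where z: "\<And>e. e > 0 \<Longrightarrow>
      eventually (\<lambda>y. \<bar>G y - G xb - z \<bullet> (y - xb)\<bar> \<le> e * norm (y - xb)) (at xb)"
    using strictly_differentiable_imp_differentiable[where G = G, OF sd g_eq[OF xbU] ev_g] by blast
  \<comment> \<open>The subgradient inequality bounds \<open>q \<bullet> (y - xb)\<close> by
    \<open>G y - G xb\<close> up to a quadratic error, and differentiability replaces this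
    difference by \<open>z \<bullet> (y - xb)\<close> up to a small linear one.\<close>
  have "q - z = 0"
  proof (rule sublinear_functional_zero)
    fix e :: real assume "e > 0"
    hence e: "e / 2 > 0" by simp
    from z[OF e] quadratic_le_linear_eventually[OF e, of "\<beta> / 2" xb] evU
    show "eventually (\<lambda>y. (q - z) \<bullet> (y - xb) \<le> e * norm (y - xb)) (at xb)"
    proof eventually_elim
      case (elim y)
      show ?case unfolding inner_diff_left using gq[OF elim(3)] elim(1,2) by linarith
    qed
  qed
  hence qz: "z = q" by simp
  let ?p = "q - adjoint A (Dh (A xb))"
  let ?\<phi> = "\<lambda>y. f y + ind_fun C y + ereal (h (A y)) - g y"
  have hA: "h (A xb) + adjoint A (Dh (A xb)) \<bullet> (y - xb) - ell / 2 * (onorm A)\<^sup>2 * (norm (y - xb))\<^sup>2 \<le> h (A y)" for y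
  proof -
    have bl: "bounded_linear A" using A by (simp add: linear_conv_bounded_linear)
    have d: "A y - A xb = A (y - xb)" using A by (simp add: linear_diff)
    have "h (A xb) + Dh (A xb) \<bullet> A (y - xb) - ell / 2 * (norm (A (y - xb)))\<^sup>2 \<le> h (A y)"
      using lipschitz_gradient_lower[OF h, of "A xb" "A y"] by (simp only: d)
    moreover have "Dh (A xb) \<bullet> A (y - xb) = adjoint A (Dh (A xb)) \<bullet> (y - xb)"
      by (metis adjoint_works[OF A] inner_commute)
    moreover have "ell / 2 * (norm (A (y - xb)))\<^sup>2 \<le> ell / 2 * (onorm A * norm (y - xb))\<^sup>2"
      using ell_nonneg onorm[OF bl] by (intro mult_left_mono power_mono) auto
    ultimately show ?thesis by (simp add: power_mult_distrib)
  qed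
  have "0 \<in> frechet_subdiff ?\<phi> xb"
  proof (rule frechet_subdiffI)
    show "?\<phi> xb = ereal (fb + h (A xb) - G xb)" using xb fb by (simp add: ind_fun_def g_eq[OF xbU])
  next
    fix e :: real assume "e > 0"
    hence e: "e / 2 > 0" by simp
    \<comment> \<open>One half of \<open>e\<close> absorbs the differentiability error of
      \<open>g\<close>, the other the quadratic errors with constants \<open>1 / t\<close> from the
      proximal inequality and \<open>ell / 2 * (onorm A)^2\<close> from \<open>h\<close>.\<close>
    from z[OF e] quadratic_le_linear_eventually[OF e, of "1 / t + ell / 2 * (onorm A)\<^sup>2" xb] evU
    show "eventually (\<lambda>y. ereal (fb + h (A xb) - G xb + 0 \<bullet> (y - xb) - e * norm (y - xb)) \<le> ?\<phi> y) (at xb)"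
    proof eventually_elim
      case (elim y)
      show ?case
      proof (cases "y \<in> C \<and> f y < \<infinity>")
        case True
        then obtain a where a: "f y = ereal a" using f(1)[of y] by (cases "f y") auto
        have "fb + (adjoint A (Dh (A xb)) - q) \<bullet> (xb - y) - 1 / t * (norm (y - xb))\<^sup>2 \<le> a"
          using fq[of y] True a fb by simp
        moreover have "(adjoint A (Dh (A xb)) - q) \<bullet> (xb - y) = q \<bullet> (y - xb) - adjoint A (Dh (A xb)) \<bullet> (y - xb)"
          by (simp add: inner_diff_left inner_diff_right)
        moreover have "1 / t * (norm (y - xb))\<^sup>2 + ell / 2 * (onorm A)\<^sup>2 * (norm (y - xb))\<^sup>2 \<le> e / 2 * norm (y - xb)"
          using elim(2) by (simp only: distrib_right)
        moreover have "G y - G xb - q \<bullet> (y - xb) \<le> e / 2 * norm (y - xb)" using elim(1)[unfolded qz] by linarith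
        ultimately have "fb + h (A xb) - G xb - e * norm (y - xb) \<le> a + h (A y) - G y"
          using hA[of y] by linarith
        thus ?thesis using True a by (simp add: ind_fun_def g_eq[OF elim(3)])
      next
        \<comment> \<open>\<open>f\<close> plus the indicator is infinite here while
          \<open>g y\<close> is finite, so the bound is trivial.\<close>
        case False
        hence "f y + ind_fun C y = \<infinity>" using f(1)[of y] by (auto simp: ind_fun_def)
        thus ?thesis unfolding g_eq[OF elim(3)]
          by (simp only: plus_ereal.simps minus_ereal_def uminus_ereal.simps ereal_less_eq)
      qed
    qed
  qed
  hence "0 \<in> limiting_subdiff ?\<phi> xb" using frechet_subset_limiting by blast
  thus ?thesis using xb by (simp add: stationary_point_def)
qed

end

theorem theorem3p3:
  fixes C U :: "'a::euclidean_space set"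
    and A :: "'a \<Rightarrow> 'b::euclidean_space"
    and f g :: "'a \<Rightarrow> ereal"
    and h :: "'b \<Rightarrow> real"
    and Dh :: "'b \<Rightarrow> 'b"
    and ell \<beta> lam_max mu_max \<delta> c :: real
    and \<tau> lam \<mu> :: "nat \<Rightarrow> real"
    and gs x :: "nat \<Rightarrow> 'a"
    and F :: "'a \<Rightarrow> ereal"
  assumes C: "C \<noteq> {}" "closed C"
    and A: "linear A"
    and f: "proper_fun f" "lsc f"
    and h: "\<forall>y. GDERIV h y :> Dh y" "ell-lipschitz_on UNIV Dh"
    and g_range: "\<forall>y. g y \<noteq> -\<infinity>"
    and U: "open U" "convex U" "C \<subseteq> U"
    and g: "\<forall>y\<in>U. \<bar>g y\<bar> \<noteq> \<infinity>" "continuous_on U g" "weakly_convex_modulus_on U g \<beta>"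
    and F_def: "F = objective f h A g"
    and params: "lam_max \<ge> 0" "mu_max \<ge> 0" "\<delta> > 0"
    and alg: "prox_subgrad_extrapolation C f Dh ell A g \<beta> lam_max mu_max \<delta> \<tau> lam \<mu> gs x"
    and F_bounded_below: "\<exists>m::real. \<forall>y\<in>C. ereal m \<le> F y"
    and C0_bounded: "bounded {y \<in> C. F y \<le> F (x 0)}"
    and c_def: "c = 1 / 2 * (ell * (onorm A)\<^sup>2 * lam_max + mu_max)"
  shows
    "((\<forall>n. (F (x (Suc n)) + ereal (c * (norm (x (Suc n) - x n))\<^sup>2))
              + ereal (\<delta> * (norm (x (Suc n) - x n))\<^sup>2)
            \<le> F (x n) + ereal (c * (norm (x n - x (n - 1)))\<^sup>2))
      \<and> (\<exists>L::real. (\<lambda>n. F (x n)) \<longlonglongrightarrow> ereal L))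
     \<and>
     (bounded (range x) \<and> (\<lambda>n. x (Suc n) - x n) \<longlonglongrightarrow> 0)
     \<and>
     (\<forall>(tau_inf::real) xbar.
        liminf (\<lambda>n. ereal (\<tau> n)) = ereal tau_inf \<and> tau_inf > 0 \<and>
        (\<exists>r. strict_mono r \<and> (x \<circ> r) \<longlonglongrightarrow> xbar) \<longrightarrow>
          xbar \<in> C \<inter> edom f \<and>
          (\<lambda>n. F (x n)) \<longlonglongrightarrow> F xbar \<and>
          lifted_stationary_point C f Dh A g xbar \<and>
          ((\<exists>V. open V \<and> C \<inter> edom f \<subseteq> V \<and> (\<forall>y\<in>V. strictly_differentiable g y)) \<longrightarrow>
             stationary_point C f h A g xbar))"
proof -
  have f': "f y \<noteq> -\<infinity>" for y using f(1) by (simp add: proper_fun_def)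
  have h': "GDERIV h y :> Dh y" for y using h(1) by blast
  interpret prox_subgrad C U A f g h Dh ell \<beta> lam_max mu_max \<delta> c \<tau> lam \<mu> gs x F
    by (rule prox_subgrad.intro[OF C(2) A f' f(2) h' h(2) U g F_def params alg F_bounded_below
          C0_bounded c_def])
  have "\<exists>L::real. (\<lambda>n. F (x n)) \<longlonglongrightarrow> ereal L" using F_convergent by blast
  moreover have "xbar \<in> C \<inter> edom f \<and> (\<lambda>n. F (x n)) \<longlonglongrightarrow> F xbar \<and>
      lifted_stationary_point C f Dh A g xbar \<and>
      ((\<exists>V. open V \<and> C \<inter> edom f \<subseteq> V \<and> (\<forall>y\<in>V. strictly_differentiable g y)) \<longrightarrow>
        stationary_point C f h A g xbar)"
    if tau: "liminf (\<lambda>n. ereal (\<tau> n)) = ereal tau_inf" "tau_inf > 0"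
      and r: "strict_mono r" "(x \<circ> r) \<longlonglongrightarrow> xbar" for tau_inf xbar r
  proof -
    obtain q where xbar: "xbar \<in> C" "f xbar < \<infinity>" and lim: "(\<lambda>n. F (x n)) \<longlonglongrightarrow> F xbar"
      and ineqs: "\<And>y. y \<in> C \<Longrightarrow>
        f xbar + ereal ((adjoint A (Dh (A xbar)) - q) \<bullet> (xbar - y) - (norm (y - xbar))\<^sup>2 / tau_inf) \<le> f y"
        "\<And>y. y \<in> U \<Longrightarrow> G xbar + q \<bullet> (y - xbar) - \<beta> / 2 * (norm (y - xbar))\<^sup>2 \<le> G y"
      using cluster_point_inequalities[OF tau r] by metis
    have dom: "xbar \<in> C \<inter> edom f" using xbar by (simp add: edom_def)
    moreover have "lifted_stationary_point C f Dh A g xbar"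
      by (rule quadratic_subgradients_imp_lifted_stationary[OF xbar ineqs])
    \<comment> \<open>\<open>xbar\<close> belongs to \<open>V\<close>, so \<open>g\<close> is
      strictly differentiable at \<open>xbar\<close>.\<close>
    moreover have "stationary_point C f h A g xbar"
      if "open V" "C \<inter> edom f \<subseteq> V" "\<forall>y\<in>V. strictly_differentiable g y" for V
      using that dom by (intro quadratic_subgradients_imp_stationary[OF xbar ineqs]) auto
    ultimately show ?thesis using lim by blast
  qed
  ultimately show ?thesis using F_decrease bounded_x steps_tendsto_0 by blast
qed

end
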